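(* Every finitely presented MV-algebra is hopfian. Every finitely generated projective MV-algebra is hopfian. In particular, every finitely generated free MV-algebra is hopfian.
   Context: An MV-algebra is an abelian monoid $(A,0,\oplus)$ with a unary operation $\neg$ satisfying $\neg\neg x=x$, $x\oplus\neg 0=\neg 0$ and $\neg(\neg x\oplus y)\oplus y=\neg(\neg y\oplus x)\oplus x$. All MV-algebras are assumed nontrivial. An MV-algebra $F$ is projective if whenever $\psi\colon A\to B$ is a surjective homomorphism of MV-algebras and $\phi\colon F\to B$ is a homomorphism, there is a homomorphism $\theta\colon F\to A$ with $\phi=\psi\circ\theta$. An MV-algebra $A$ is hopfian if every homomorphism of $A$ onto $A$ is an automorphism. *)

theory Defs
  imports "HOL-Algebra.Group"
begin

section \<open>MV-algebras\<close>

record 'a mv = "'a partial_object" +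
  mv_zero :: 'a ("\<zero>\<index>")
  mv_plus :: "'a \<Rightarrow> 'a \<Rightarrow> 'a" (infixl "\<oplus>\<index>" 65)
  mv_neg :: "'a \<Rightarrow> 'a" ("\<sim>\<index> _" [81] 80)

text \<open>The axiom \<open>nontrivial\<close> reflects the convention that all MV-algebras have more than one element.\<close>

locale mv_algebra =
  fixes A :: "'a mv" (structure)
  assumes plus_comm_monoid:
      "comm_monoid \<lparr>carrier = carrier A, monoid.mult = (\<oplus>), one = \<zero>\<rparr>"
    and neg_closed: "x \<in> carrier A \<Longrightarrow> \<sim> x \<in> carrier A"
    and neg_neg: "x \<in> carrier A \<Longrightarrow> \<sim> (\<sim> x) = x"
    and plus_neg_zero: "x \<in> carrier A \<Longrightarrow> x \<oplus> \<sim> \<zero> = \<sim> \<zero>"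
    and mv_axiom: "\<lbrakk>x \<in> carrier A; y \<in> carrier A\<rbrakk> \<Longrightarrow>
      \<sim> (\<sim> x \<oplus> y) \<oplus> y = \<sim> (\<sim> y \<oplus> x) \<oplus> x"
    and nontrivial: "\<exists>x\<in>carrier A. \<exists>y\<in>carrier A. x \<noteq> y"

definition mv_hom :: "'a mv \<Rightarrow> 'b mv \<Rightarrow> ('a \<Rightarrow> 'b) set" where
  "mv_hom A B = {f \<in> carrier A \<rightarrow> carrier B.
     f \<zero>\<^bsub>A\<^esub> = \<zero>\<^bsub>B\<^esub> \<and>
     (\<forall>x\<in>carrier A. \<forall>y\<in>carrier A. f (x \<oplus>\<^bsub>A\<^esub> y) = f x \<oplus>\<^bsub>B\<^esub> f y) \<and>
     (\<forall>x\<in>carrier A. f (\<sim>\<^bsub>A\<^esub> x) = \<sim>\<^bsub>B\<^esub> (f x))}"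

definition mv_iso :: "'a mv \<Rightarrow> 'b mv \<Rightarrow> ('a \<Rightarrow> 'b) set" where
  "mv_iso A B = {f \<in> mv_hom A B. bij_betw f (carrier A) (carrier B)}"

definition mv_isomorphic :: "'a mv \<Rightarrow> 'b mv \<Rightarrow> bool" where
  "mv_isomorphic A B \<longleftrightarrow> mv_iso A B \<noteq> {}"

definition mv_hopfian :: "'a mv \<Rightarrow> bool" where
  "mv_hopfian A \<longleftrightarrow>
     (\<forall>f\<in>mv_hom A A. f ` carrier A = carrier A \<longrightarrow> f \<in> mv_iso A A)"

inductive_set mv_generate :: "'a mv \<Rightarrow> 'a set \<Rightarrow> 'a set" for A and S where
  incl: "x \<in> S \<Longrightarrow> x \<in> mv_generate A S"
| zero: "\<zero>\<^bsub>A\<^esub> \<in> mv_generate A S"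
| plus: "\<lbrakk>x \<in> mv_generate A S; y \<in> mv_generate A S\<rbrakk> \<Longrightarrow> x \<oplus>\<^bsub>A\<^esub> y \<in> mv_generate A S"
| neg: "x \<in> mv_generate A S \<Longrightarrow> \<sim>\<^bsub>A\<^esub> x \<in> mv_generate A S"

definition mv_finitely_generated :: "'a mv \<Rightarrow> bool" where
  "mv_finitely_generated A \<longleftrightarrow>
     (\<exists>S. finite S \<and> S \<subseteq> carrier A \<and> mv_generate A S = carrier A)"


section \<open>Presentations and free algebras\<close>

datatype (mv_vars: 'v) mv_term =
  MVar 'v | MZero | MPlus "'v mv_term" "'v mv_term" | MNeg "'v mv_term"

definition mv_terms :: "'v set \<Rightarrow> 'v mv_term set" where
  "mv_terms X = {t. mv_vars t \<subseteq> X}"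

text \<open>
  The congruence on the terms over \<open>X\<close> generated by the MV-algebra axioms and the relations \<open>R\<close>,
  where a pair \<open>(s, t)\<close> in \<open>R\<close> stands for the relation \<open>s = t\<close>.
\<close>

inductive_set mv_cong :: "'v set \<Rightarrow> ('v mv_term \<times> 'v mv_term) set \<Rightarrow> ('v mv_term \<times> 'v mv_term) set"
  for X R where
  rel: "(s, t) \<in> R \<Longrightarrow> (s, t) \<in> mv_cong X R"
| refl: "t \<in> mv_terms X \<Longrightarrow> (t, t) \<in> mv_cong X R"
| sym: "(s, t) \<in> mv_cong X R \<Longrightarrow> (t, s) \<in> mv_cong X R"
| trans: "\<lbrakk>(s, t) \<in> mv_cong X R; (t, u) \<in> mv_cong X R\<rbrakk> \<Longrightarrow> (s, u) \<in> mv_cong X R"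
| plus: "\<lbrakk>(s, s') \<in> mv_cong X R; (t, t') \<in> mv_cong X R\<rbrakk> \<Longrightarrow>
    (MPlus s t, MPlus s' t') \<in> mv_cong X R"
| neg: "(s, t) \<in> mv_cong X R \<Longrightarrow> (MNeg s, MNeg t) \<in> mv_cong X R"
| plus_assoc: "\<lbrakk>s \<in> mv_terms X; t \<in> mv_terms X; u \<in> mv_terms X\<rbrakk> \<Longrightarrow>
    (MPlus (MPlus s t) u, MPlus s (MPlus t u)) \<in> mv_cong X R"
| plus_comm: "\<lbrakk>s \<in> mv_terms X; t \<in> mv_terms X\<rbrakk> \<Longrightarrow> (MPlus s t, MPlus t s) \<in> mv_cong X R"
| plus_zero: "t \<in> mv_terms X \<Longrightarrow> (MPlus t MZero, t) \<in> mv_cong X R"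
| neg_neg: "t \<in> mv_terms X \<Longrightarrow> (MNeg (MNeg t), t) \<in> mv_cong X R"
| plus_neg_zero: "t \<in> mv_terms X \<Longrightarrow> (MPlus t (MNeg MZero), MNeg MZero) \<in> mv_cong X R"
| mv_axiom: "\<lbrakk>s \<in> mv_terms X; t \<in> mv_terms X\<rbrakk> \<Longrightarrow>
    (MPlus (MNeg (MPlus (MNeg s) t)) t, MPlus (MNeg (MPlus (MNeg t) s)) s) \<in> mv_cong X R"

definition mv_presented :: "'v set \<Rightarrow> ('v mv_term \<times> 'v mv_term) set \<Rightarrow> 'v mv_term set mv" where
  "mv_presented X R =
     \<lparr>carrier = mv_terms X // mv_cong X R,
      mv_zero = mv_cong X R `` {MZero},
      mv_plus = (\<lambda>C D. \<Union>s\<in>C. \<Union>t\<in>D. mv_cong X R `` {MPlus s t}),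
      mv_neg = (\<lambda>C. \<Union>s\<in>C. mv_cong X R `` {MNeg s})\<rparr>"

text \<open>A presentation may collapse to one element, so \<open>A\<close> itself is still required to be an
  MV-algebra wherever this predicate is used.\<close>

definition mv_finitely_presented :: "'a mv \<Rightarrow> bool" where
  "mv_finitely_presented A \<longleftrightarrow>
     (\<exists>(n::nat) R. finite R \<and> R \<subseteq> mv_terms {..<n} \<times> mv_terms {..<n} \<and>
        mv_isomorphic A (mv_presented {..<n} R))"

text \<open>
  The free MV-algebra over \<open>X\<close> is \<open>mv_presented X {}\<close>; see \<open>mv_free_universal\<close> below.
  Since distinct free generators are distinct elements, it is no restriction to take
  the set \<open>X\<close> of generators inside the type \<open>'a\<close> of the algebra.
\<close>

definition mv_free :: "'a mv \<Rightarrow> bool" where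
  "mv_free F \<longleftrightarrow> (\<exists>X :: 'a set. mv_isomorphic F (mv_presented X {}))"


section \<open>Projective algebras\<close>

text \<open>
  A definition cannot quantify over types, so \<open>A\<close> and \<open>B\<close> range over the MV-algebras on one type,
  chosen large enough to contain a copy of \<open>F\<close> and of the free algebra over the elements of \<open>F\<close>.
  Lemma \<open>mv_projective_lifting\<close> below shows that the lifting property then holds for \<open>A\<close> and \<open>B\<close>
  on arbitrary types.
\<close>

definition mv_projective :: "'a mv \<Rightarrow> bool" where
  "mv_projective F \<longleftrightarrow>
     (\<forall>(A :: 'a mv_term set mv) (B :: 'a mv_term set mv).
        mv_algebra A \<longrightarrow> mv_algebra B \<longrightarrow>
        (\<forall>\<psi>\<in>mv_hom A B. \<psi> ` carrier A = carrier B \<longrightarrow>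
          (\<forall>\<phi>\<in>mv_hom F B. \<exists>\<theta>\<in>mv_hom F A. \<forall>x\<in>carrier F. \<phi> x = \<psi> (\<theta> x))))"


section \<open>Universal property of presentations, and lifting over arbitrary types\<close>

context mv_algebra
begin

lemma
  shows zero_closed: "\<zero> \<in> carrier A"
    and plus_closed: "x \<in> carrier A \<Longrightarrow> y \<in> carrier A \<Longrightarrow> x \<oplus> y \<in> carrier A"
    and plus_assoc: "\<lbrakk>x \<in> carrier A; y \<in> carrier A; z \<in> carrier A\<rbrakk> \<Longrightarrow> x \<oplus> y \<oplus> z = x \<oplus> (y \<oplus> z)"
    and plus_comm: "\<lbrakk>x \<in> carrier A; y \<in> carrier A\<rbrakk> \<Longrightarrow> x \<oplus> y = y \<oplus> x"
    and plus_zero: "x \<in> carrier A \<Longrightarrow> x \<oplus> \<zero> = x"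
proof -
  interpret M: comm_monoid "\<lparr>carrier = carrier A, monoid.mult = (\<oplus>), one = \<zero>\<rparr>"
    by (rule plus_comm_monoid)
  show "\<zero> \<in> carrier A"
    using M.one_closed by simp
  show "x \<in> carrier A \<Longrightarrow> y \<in> carrier A \<Longrightarrow> x \<oplus> y \<in> carrier A"
    using M.m_closed by simp
  show "\<lbrakk>x \<in> carrier A; y \<in> carrier A; z \<in> carrier A\<rbrakk> \<Longrightarrow> x \<oplus> y \<oplus> z = x \<oplus> (y \<oplus> z)"
    using M.m_assoc by simp
  show "\<lbrakk>x \<in> carrier A; y \<in> carrier A\<rbrakk> \<Longrightarrow> x \<oplus> y = y \<oplus> x"
    using M.m_comm by simp
  show "x \<in> carrier A \<Longrightarrow> x \<oplus> \<zero> = x"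
    using M.r_one by simp
qed

end

lemma mv_terms_simps [simp]:
  "MVar x \<in> mv_terms X \<longleftrightarrow> x \<in> X"
  "MZero \<in> mv_terms X"
  "MPlus s t \<in> mv_terms X \<longleftrightarrow> s \<in> mv_terms X \<and> t \<in> mv_terms X"
  "MNeg t \<in> mv_terms X \<longleftrightarrow> t \<in> mv_terms X"
  by (auto simp: mv_terms_def)

lemma mv_cong_terms:
  assumes "R \<subseteq> mv_terms X \<times> mv_terms X" "(s, t) \<in> mv_cong X R"
  shows "s \<in> mv_terms X \<and> t \<in> mv_terms X"
  using assms(2) by induction (use assms(1) in auto)

lemma equiv_mv_cong:
  assumes "R \<subseteq> mv_terms X \<times> mv_terms X"
  shows "equiv (mv_terms X) (mv_cong X R)"
proof (rule equivI)
  show "mv_cong X R \<subseteq> mv_terms X \<times> mv_terms X"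
    using mv_cong_terms[OF assms] by auto
  show "refl_on (mv_terms X) (mv_cong X R)"
    by (auto simp: refl_on_def intro: mv_cong.refl)
  show "sym (mv_cong X R)"
    by (auto intro: symI mv_cong.sym)
  show "trans (mv_cong X R)"
    by (auto intro: transI mv_cong.trans)
qed

context
  fixes X :: "'v set" and R :: "('v mv_term \<times> 'v mv_term) set"
  assumes R: "R \<subseteq> mv_terms X \<times> mv_terms X"
begin

lemma mv_presented_carrier:
  "C \<in> carrier (mv_presented X R) \<longleftrightarrow> (\<exists>t\<in>mv_terms X. C = mv_cong X R `` {t})"
  by (auto simp: mv_presented_def quotient_def)

lemma mv_class_carrier: "t \<in> mv_terms X \<Longrightarrow> mv_cong X R `` {t} \<in> carrier (mv_presented X R)"
  by (auto simp only: mv_presented_carrier)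

lemma mv_class_eq_iff:
  assumes "s \<in> mv_terms X" "t \<in> mv_terms X"
  shows "mv_cong X R `` {s} = mv_cong X R `` {t} \<longleftrightarrow> (s, t) \<in> mv_cong X R"
  using eq_equiv_class_iff[OF equiv_mv_cong[OF R] assms] .

lemma mv_presented_zero: "\<zero>\<^bsub>mv_presented X R\<^esub> = mv_cong X R `` {MZero}"
  by (simp add: mv_presented_def)

lemma mv_presented_plus:
  assumes "s \<in> mv_terms X" "t \<in> mv_terms X"
  shows "mv_cong X R `` {s} \<oplus>\<^bsub>mv_presented X R\<^esub> mv_cong X R `` {t} = mv_cong X R `` {MPlus s t}"
proof -
  have "(\<lambda>s t. mv_cong X R `` {MPlus s t}) respects2 mv_cong X R"
    by (rule congruent2I')
      (metis R equiv_class_eq equiv_mv_cong mv_cong.plus)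
  then show ?thesis
    using UN_equiv_class2[OF equiv_mv_cong[OF R] equiv_mv_cong[OF R]] assms
    by (simp add: mv_presented_def)
qed

lemma mv_presented_neg:
  assumes "s \<in> mv_terms X"
  shows "\<sim>\<^bsub>mv_presented X R\<^esub> (mv_cong X R `` {s}) = mv_cong X R `` {MNeg s}"
proof -
  have "(\<lambda>s. mv_cong X R `` {MNeg s}) respects mv_cong X R"
    by (rule congruentI)
      (metis R equiv_class_eq equiv_mv_cong mv_cong.neg)
  then show ?thesis
    using UN_equiv_class[OF equiv_mv_cong[OF R]] assms
    by (simp add: mv_presented_def)
qed

end

lemmas mv_presented_simps =
  mv_presented_carrier mv_presented_zero mv_presented_plus mv_presented_neg

lemma mv_presented_mv_algebra:
  assumes R: "R \<subseteq> mv_terms X \<times> mv_terms X" and nontriv: "(MZero, MNeg MZero) \<notin> mv_cong X R"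
  shows "mv_algebra (mv_presented X R)"
proof -
  let ?P = "mv_presented X R"
  note S = mv_presented_carrier[OF R] mv_presented_zero[OF R] mv_presented_plus[OF R]
    mv_presented_neg[OF R] mv_class_eq_iff[OF R]
  show ?thesis
  proof (rule mv_algebra.intro)
    show "comm_monoid \<lparr>carrier = carrier ?P, monoid.mult = (\<oplus>\<^bsub>?P\<^esub>), one = \<zero>\<^bsub>?P\<^esub>\<rparr>"
    proof (rule comm_monoidI, goal_cases)
      case (1 x y)
      then obtain s t where "s \<in> mv_terms X" "t \<in> mv_terms X"
        "x = mv_cong X R `` {s}" "y = mv_cong X R `` {t}"
        by (auto simp: S)
      then show ?case
        by (auto simp: S intro!: bexI[of _ "MPlus s t"] mv_cong.refl)
    next
      case 2
      then show ?case
        by (auto simp: S intro!: bexI[of _ MZero] mv_cong.refl)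
    next
      case (3 x y z)
      then obtain s t u where "s \<in> mv_terms X" "t \<in> mv_terms X" "u \<in> mv_terms X"
        "x = mv_cong X R `` {s}" "y = mv_cong X R `` {t}" "z = mv_cong X R `` {u}"
        by (auto simp: S)
      then show ?case
        by (simp add: S mv_cong.plus_assoc)
    next
      case (4 x)
      then obtain s where s: "s \<in> mv_terms X" "x = mv_cong X R `` {s}"
        by (auto simp: S)
      have "(MPlus MZero s, s) \<in> mv_cong X R"
        using mv_cong.trans[OF mv_cong.plus_comm mv_cong.plus_zero] s(1) by simp
      with s show ?case
        by (simp add: S)
    next
      case (5 x y)
      then obtain s t where "s \<in> mv_terms X" "t \<in> mv_terms X"
        "x = mv_cong X R `` {s}" "y = mv_cong X R `` {t}"
        by (auto simp: S)
      then show ?case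
        by (simp add: S mv_cong.plus_comm)
    qed
    show "\<sim>\<^bsub>?P\<^esub> x \<in> carrier ?P" if x: "x \<in> carrier ?P" for x
    proof -
      obtain s where "s \<in> mv_terms X" "x = mv_cong X R `` {s}"
        using x by (auto simp: S)
      then show ?thesis
        by (auto simp: S intro!: bexI[of _ "MNeg s"] mv_cong.refl)
    qed
    show "\<exists>x\<in>carrier ?P. \<exists>y\<in>carrier ?P. x \<noteq> y"
      by (rule bexI[of _ "mv_cong X R `` {MZero}"], rule bexI[of _ "mv_cong X R `` {MNeg MZero}"])
        (use nontriv in \<open>simp_all add: mv_class_carrier[OF R] mv_class_eq_iff[OF R]\<close>)
    show "\<sim>\<^bsub>?P\<^esub> (\<sim>\<^bsub>?P\<^esub> x) = x" if x: "x \<in> carrier ?P" for x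
    proof -
      obtain s where "s \<in> mv_terms X" "x = mv_cong X R `` {s}"
        using x by (auto simp: S)
      then show ?thesis
        by (simp add: S mv_cong.neg_neg)
    qed
    show "x \<oplus>\<^bsub>?P\<^esub> \<sim>\<^bsub>?P\<^esub> \<zero>\<^bsub>?P\<^esub> = \<sim>\<^bsub>?P\<^esub> \<zero>\<^bsub>?P\<^esub>" if x: "x \<in> carrier ?P" for x
    proof -
      obtain s where "s \<in> mv_terms X" "x = mv_cong X R `` {s}"
        using x by (auto simp: S)
      then show ?thesis
        by (simp add: S mv_cong.plus_neg_zero)
    qed
    show "\<sim>\<^bsub>?P\<^esub> (\<sim>\<^bsub>?P\<^esub> x \<oplus>\<^bsub>?P\<^esub> y) \<oplus>\<^bsub>?P\<^esub> y = \<sim>\<^bsub>?P\<^esub> (\<sim>\<^bsub>?P\<^esub> y \<oplus>\<^bsub>?P\<^esub> x) \<oplus>\<^bsub>?P\<^esub> x"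
      if xy: "x \<in> carrier ?P" "y \<in> carrier ?P" for x y
    proof -
      obtain s t where "s \<in> mv_terms X" "t \<in> mv_terms X"
        "x = mv_cong X R `` {s}" "y = mv_cong X R `` {t}"
        using xy by (auto simp: S)
      then show ?thesis
        by (simp add: S mv_cong.mv_axiom)
    qed
  qed
qed

primrec mv_eval :: "'b mv \<Rightarrow> ('v \<Rightarrow> 'b) \<Rightarrow> 'v mv_term \<Rightarrow> 'b" where
  "mv_eval B h (MVar x) = h x"
| "mv_eval B h MZero = \<zero>\<^bsub>B\<^esub>"
| "mv_eval B h (MPlus s t) = mv_eval B h s \<oplus>\<^bsub>B\<^esub> mv_eval B h t"
| "mv_eval B h (MNeg t) = \<sim>\<^bsub>B\<^esub> (mv_eval B h t)"

lemma (in mv_algebra) mv_eval_closed: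
  assumes "h \<in> X \<rightarrow> carrier A" "t \<in> mv_terms X"
  shows "mv_eval A h t \<in> carrier A"
  using assms(2) by (induction t) (use assms(1) in \<open>auto intro: zero_closed plus_closed neg_closed\<close>)

lemma (in mv_algebra) mv_eval_cong:
  assumes R: "R \<subseteq> mv_terms X \<times> mv_terms X" and h: "h \<in> X \<rightarrow> carrier A"
    and hR: "\<And>s t. (s, t) \<in> R \<Longrightarrow> mv_eval A h s = mv_eval A h t"
    and "(s, t) \<in> mv_cong X R"
  shows "mv_eval A h s = mv_eval A h t"
  using assms(4)
proof induction
  case (mv_axiom s t)
  then show ?case
    using mv_algebra.mv_axiom[OF mv_algebra_axioms] mv_eval_closed[OF h] by simp
qed (auto simp: mv_eval_closed[OF h] hR plus_assoc plus_zero neg_neg plus_neg_zero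
      intro: plus_comm mv_eval_closed[OF h])

lemma (in mv_algebra) zero_neq_one: "\<zero> \<noteq> \<sim> \<zero>"
proof
  assume *: "\<zero> = \<sim> \<zero>"
  have "x = \<zero>" if "x \<in> carrier A" for x
    using that plus_zero[of x] plus_neg_zero[of x] * by simp
  then show False
    using nontrivial by blast
qed

lemma mv_hom_eval:
  assumes "f \<in> mv_hom A B" "mv_algebra A" "h \<in> X \<rightarrow> carrier A" "t \<in> mv_terms X"
  shows "f (mv_eval A h t) = mv_eval B (f \<circ> h) t"
  using assms(4)
  by (induction t) (use assms(1) mv_algebra.mv_eval_closed[OF assms(2,3)] in \<open>auto simp: mv_hom_def\<close>)

lemma mv_eval_presented:
  assumes "R \<subseteq> mv_terms X \<times> mv_terms X" "t \<in> mv_terms X"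
  shows "mv_eval (mv_presented X R) (\<lambda>x. mv_cong X R `` {MVar x}) t = mv_cong X R `` {t}"
  using assms(2) by (induction t) (simp_all add: mv_presented_simps[OF assms(1)])

lemma mv_presented_mv_algebra_of_model:
  assumes "mv_algebra A" "R \<subseteq> mv_terms X \<times> mv_terms X" "h \<in> X \<rightarrow> carrier A"
    and "\<And>s t. (s, t) \<in> R \<Longrightarrow> mv_eval A h s = mv_eval A h t"
  shows "mv_algebra (mv_presented X R)"
  using mv_presented_mv_algebra[OF assms(2)] mv_algebra.mv_eval_cong[OF assms]
    mv_algebra.zero_neq_one[OF assms(1)] by fastforce

lemma mv_presented_hom:
  assumes A: "mv_algebra A" and R: "R \<subseteq> mv_terms X \<times> mv_terms X" and h: "h \<in> X \<rightarrow> carrier A"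
    and hR: "\<And>s t. (s, t) \<in> R \<Longrightarrow> mv_eval A h s = mv_eval A h t"
  obtains g where "g \<in> mv_hom (mv_presented X R) A"
    and "\<And>t. t \<in> mv_terms X \<Longrightarrow> g (mv_cong X R `` {t}) = mv_eval A h t"
proof
  define g where "g C = mv_eval A h (SOME t. t \<in> C)" for C
  show g: "g (mv_cong X R `` {t}) = mv_eval A h t" if "t \<in> mv_terms X" for t
  proof -
    have "(SOME u. u \<in> mv_cong X R `` {t}) \<in> mv_cong X R `` {t}"
      by (rule someI[of _ t]) (use that in \<open>auto intro: mv_cong.refl\<close>)
    then show ?thesis
      using mv_algebra.mv_eval_cong[OF A R h hR] by (auto simp: g_def)
  qed
  show "g \<in> mv_hom (mv_presented X R) A"
    by (auto simp: mv_hom_def mv_presented_simps[OF R] g mv_algebra.mv_eval_closed[OF A h])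
qed

theorem mv_free_universal:
  assumes A: "mv_algebra A" and h: "h \<in> X \<rightarrow> carrier A"
  shows "\<exists>g\<in>mv_hom (mv_presented X {}) A.
    (\<forall>x\<in>X. g (mv_cong X {} `` {MVar x}) = h x) \<and>
    (\<forall>g'\<in>mv_hom (mv_presented X {}) A. (\<forall>x\<in>X. g' (mv_cong X {} `` {MVar x}) = h x) \<longrightarrow>
      (\<forall>C\<in>carrier (mv_presented X {}). g' C = g C))"
proof -
  have E: "{} \<subseteq> mv_terms X \<times> mv_terms X"
    by simp
  obtain g where g: "g \<in> mv_hom (mv_presented X {}) A"
      "\<And>t. t \<in> mv_terms X \<Longrightarrow> g (mv_cong X {} `` {t}) = mv_eval A h t"
    using mv_presented_hom[OF A E h] by blast
  have "g' (mv_cong X {} `` {t}) = mv_eval A h t"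
    if g': "g' \<in> mv_hom (mv_presented X {}) A" "\<forall>x\<in>X. g' (mv_cong X {} `` {MVar x}) = h x"
      and t: "t \<in> mv_terms X" for g' t
    using t
  proof (induction t)
    case (MPlus s t)
    then show ?case
      using g'(1) mv_presented_plus[OF E, of s t, symmetric]
      by (simp add: mv_hom_def mv_class_carrier[OF E])
  next
    case (MNeg t)
    then show ?case
      using g'(1) mv_presented_neg[OF E, of t, symmetric]
      by (simp add: mv_hom_def mv_class_carrier[OF E])
  qed (use g' in \<open>auto simp: mv_hom_def mv_presented_zero[OF E]\<close>)
  with g show ?thesis
    by (intro bexI[of _ g]) (auto simp: mv_presented_carrier[OF E])
qed

theorem mv_projective_lifting:
  fixes F :: "'a mv" and A :: "'b mv" and B :: "'c mv"
  assumes proj: "mv_projective F" and F: "mv_algebra F" and A: "mv_algebra A" and B: "mv_algebra B"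
    and \<psi>: "\<psi> \<in> mv_hom A B" "\<psi> ` carrier A = carrier B" and \<phi>: "\<phi> \<in> mv_hom F B"
  shows "\<exists>\<theta>\<in>mv_hom F A. \<forall>x\<in>carrier F. \<phi> x = \<psi> (\<theta> x)"
proof -
  define X where "X = carrier F"
  define R where "R = {(s, t). s \<in> mv_terms X \<and> t \<in> mv_terms X \<and> mv_eval F id s = mv_eval F id t}"
  have E: "{} \<subseteq> mv_terms X \<times> mv_terms X" and R: "R \<subseteq> mv_terms X \<times> mv_terms X"
    by (auto simp: R_def)
  have id: "id \<in> X \<rightarrow> carrier F"
    by (auto simp: X_def)
  have idR: "\<And>s t. (s, t) \<in> R \<Longrightarrow> mv_eval F id s = mv_eval F id t"
    by (auto simp: R_def)
  let ?G = "mv_presented X {}" and ?H = "mv_presented X R"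
  have G: "mv_algebra ?G"
    using mv_presented_mv_algebra_of_model[OF F E id] by blast
  have H: "mv_algebra ?H"
    by (rule mv_presented_mv_algebra_of_model[OF F R id idR])
  have "(\<lambda>x. mv_cong X R `` {MVar x}) \<in> X \<rightarrow> carrier ?H"
    by (simp add: mv_class_carrier[OF R])
  then obtain q where q: "q \<in> mv_hom ?G ?H"
      "\<And>t. t \<in> mv_terms X \<Longrightarrow> q (mv_cong X {} `` {t}) = mv_cong X R `` {t}"
    using mv_presented_hom[OF H E] mv_eval_presented[OF R] by (metis empty_iff)
  have q_surj: "q ` carrier ?G = carrier ?H"
    using q(2) by (force simp: mv_presented_carrier[OF E] mv_presented_carrier[OF R] image_iff)
  have r: "(\<lambda>x. mv_cong X R `` {MVar x}) \<in> mv_hom F ?H"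
  proof -
    have "\<zero>\<^bsub>F\<^esub> \<in> X" "\<And>x y. x \<in> X \<Longrightarrow> y \<in> X \<Longrightarrow> x \<oplus>\<^bsub>F\<^esub> y \<in> X" "\<And>x. x \<in> X \<Longrightarrow> \<sim>\<^bsub>F\<^esub> x \<in> X"
      using F by (auto simp: X_def mv_algebra.zero_closed mv_algebra.plus_closed mv_algebra.neg_closed)
    moreover have "(s, t) \<in> mv_cong X R"
      if "s \<in> mv_terms X" "t \<in> mv_terms X" "mv_eval F id s = mv_eval F id t" for s t
      using that by (intro mv_cong.rel) (simp add: R_def)
    ultimately show ?thesis
      by (simp add: mv_hom_def mv_presented_zero[OF R] mv_presented_plus[OF R]
          mv_presented_neg[OF R] mv_class_eq_iff[OF R] mv_class_carrier[OF R] flip: X_def)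
  qed
  have "\<exists>\<theta>\<in>mv_hom F ?G. \<forall>x\<in>carrier F. mv_cong X R `` {MVar x} = q (\<theta> x)"
    using proj[unfolded mv_projective_def, rule_format, OF G H q(1) q_surj r] .
  then obtain s where s: "s \<in> mv_hom F ?G"
      "\<And>x. x \<in> carrier F \<Longrightarrow> mv_cong X R `` {MVar x} = q (s x)"
    by blast
  have s_term: "\<exists>t\<in>mv_terms X. s x = mv_cong X {} `` {t} \<and> mv_eval F id t = x"
    if x: "x \<in> carrier F" for x
  proof -
    have "s x \<in> carrier ?G"
      using s(1) x by (auto simp: mv_hom_def)
    then obtain t where t: "t \<in> mv_terms X" "s x = mv_cong X {} `` {t}"
      by (auto simp: mv_presented_carrier[OF E])
    then have "(MVar x, t) \<in> mv_cong X R"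
      using s(2)[OF x] q(2)[OF t(1)] mv_class_eq_iff[OF R, of "MVar x" t] x by (simp add: X_def)
    then have "mv_eval F id t = x"
      using mv_algebra.mv_eval_cong[OF F R id idR] by fastforce
    with t show ?thesis
      by blast
  qed
  have "\<forall>x\<in>X. \<exists>a\<in>carrier A. \<psi> a = \<phi> x"
  proof
    fix x assume "x \<in> X"
    then have "\<phi> x \<in> \<psi> ` carrier A"
      using \<psi>(2) \<phi> by (auto simp: X_def mv_hom_def)
    then show "\<exists>a\<in>carrier A. \<psi> a = \<phi> x"
      by auto
  qed
  then obtain h where h: "h \<in> X \<rightarrow> carrier A" "\<And>x. x \<in> X \<Longrightarrow> \<psi> (h x) = \<phi> x"
    by (metis Pi_I)
  obtain g where g: "g \<in> mv_hom ?G A"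
      "\<And>t. t \<in> mv_terms X \<Longrightarrow> g (mv_cong X {} `` {t}) = mv_eval A h t"
    using mv_presented_hom[OF A E h(1)] by blast
  have eval_eq: "mv_eval B (\<psi> \<circ> h) t = mv_eval B (\<phi> \<circ> id) t" if "t \<in> mv_terms X" for t
    using that by (induction t) (auto simp: h(2))
  show ?thesis
  proof (intro bexI[of _ "g \<circ> s"] ballI)
    show "\<phi> x = \<psi> ((g \<circ> s) x)" if x: "x \<in> carrier F" for x
    proof -
      obtain t where t: "t \<in> mv_terms X" "s x = mv_cong X {} `` {t}" "mv_eval F id t = x"
        using s_term[OF x] by blast
      have "\<psi> (g (s x)) = mv_eval B (\<psi> \<circ> h) t"
        using mv_hom_eval[OF \<psi>(1) A h(1) t(1)] g(2)[OF t(1)] t(2) by simp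
      also have "\<dots> = \<phi> x"
        using eval_eq[OF t(1)] mv_hom_eval[OF \<phi> F id t(1)] t(3) by simp
      finally show ?thesis
        by simp
    qed
    show "g \<circ> s \<in> mv_hom F A"
      using g(1) s(1) by (auto simp: mv_hom_def Pi_iff)
  qed
qed

end

theory Submission
  imports Defs "HOL-Library.Multiset" Complex_Main
begin

text \<open>
  A finitely generated algebra \<open>A\<close> whose points are separated by homomorphisms \<open>h\<close> into finite
  algebras is hopfian: for a surjective endomorphism \<open>f\<close> there are only finitely many maps
  \<open>h \<circ> f\<^sup>n\<close>, so \<open>h \<circ> f\<^sup>i = h \<circ> f\<^sup>j\<close> for some \<open>i < j\<close>, whence \<open>h = h \<circ> f\<^sup>j\<^sup>-\<^sup>i\<close> and \<open>h\<close> does not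
  separate points identified by \<open>f\<close>.

  If a presentation with finitely many relations does not identify \<open>s\<close> and \<open>t\<close>, a maximal
  set of relations not identifying them presents a chain. Sums of elements of a chain carry a
  translation-invariant total order, and Fourier--Motzkin elimination assigns integer weights to
  the finitely many values of subterms so that finitely many comparisons of sums are preserved.
  These weights are a model of the relations in a finite chain, separating \<open>s\<close> from \<open>t\<close>.
  A projective algebra is a retract of a free one, hence embeds into it.
\<close>

section \<open>Arithmetic in MV-algebras\<close>

text \<open>Truncated difference: in the real unit interval it is
  \<open>max 0 (x - y)\<close>.\<close>

definition mv_minus :: "'a mv \<Rightarrow> 'a \<Rightarrow> 'a \<Rightarrow> 'a" (infixl "\<ominus>\<index>" 65) where
  "x \<ominus>\<^bsub>A\<^esub> y = \<sim>\<^bsub>A\<^esub> (\<sim>\<^bsub>A\<^esub> x \<oplus>\<^bsub>A\<^esub> y)"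

definition mv_le :: "'a mv \<Rightarrow> 'a \<Rightarrow> 'a \<Rightarrow> bool" (infix "\<sqsubseteq>\<index>" 50) where
  "x \<sqsubseteq>\<^bsub>A\<^esub> y \<longleftrightarrow> \<sim>\<^bsub>A\<^esub> x \<oplus>\<^bsub>A\<^esub> y = \<sim>\<^bsub>A\<^esub> \<zero>\<^bsub>A\<^esub>"

context mv_algebra
begin

lemmas closed [simp] = zero_closed plus_closed neg_closed

declare neg_neg [simp] plus_zero [simp] plus_neg_zero [simp]

lemma minus_closed [simp]: "x \<in> carrier A \<Longrightarrow> y \<in> carrier A \<Longrightarrow> x \<ominus> y \<in> carrier A"
  by (simp add: mv_minus_def)

lemma plus_left_comm:
  "\<lbrakk>x \<in> carrier A; y \<in> carrier A; z \<in> carrier A\<rbrakk> \<Longrightarrow> x \<oplus> (y \<oplus> z) = y \<oplus> (x \<oplus> z)"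
  by (metis plus_assoc plus_comm)

lemmas plus_ac = plus_assoc plus_comm plus_left_comm

lemma zero_plus [simp]: "x \<in> carrier A \<Longrightarrow> \<zero> \<oplus> x = x"
  by (simp add: plus_comm[of \<zero>])

lemma neg_zero_plus [simp]: "x \<in> carrier A \<Longrightarrow> \<sim> \<zero> \<oplus> x = \<sim> \<zero>"
  by (simp add: plus_comm[of "\<sim> \<zero>"])

lemma neg_plus_self [simp]: "x \<in> carrier A \<Longrightarrow> \<sim> x \<oplus> x = \<sim> \<zero>"
  \<comment> \<open>With \<open>\<sim> \<zero>\<close> for \<open>y\<close>, the left side of the
    axiom collapses to \<open>\<sim> \<zero>\<close> and the right side to
    \<open>\<sim> x \<oplus> x\<close>.\<close>
  using mv_axiom[of x "\<sim> \<zero>"] by simp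

lemma plus_neg_self [simp]: "x \<in> carrier A \<Longrightarrow> x \<oplus> \<sim> x = \<sim> \<zero>"
  by (simp add: plus_comm[of x])

lemma neg_eq_iff: "\<lbrakk>x \<in> carrier A; y \<in> carrier A\<rbrakk> \<Longrightarrow> \<sim> x = \<sim> y \<longleftrightarrow> x = y"
  by (metis neg_neg)

lemma le_iff_minus: "\<lbrakk>x \<in> carrier A; y \<in> carrier A\<rbrakk> \<Longrightarrow> x \<sqsubseteq> y \<longleftrightarrow> x \<ominus> y = \<zero>"
  by (metis closed mv_le_def mv_minus_def neg_neg)

text \<open>Both sides are the join of \<open>x\<close> and \<open>y\<close>, which the last MV
  axiom makes symmetric.\<close>

lemma minus_plus_comm:
  "\<lbrakk>x \<in> carrier A; y \<in> carrier A\<rbrakk> \<Longrightarrow> (x \<ominus> y) \<oplus> y = (y \<ominus> x) \<oplus> x"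
  by (simp add: mv_minus_def mv_axiom)

lemma minus_plus_cancel:
  "\<lbrakk>x \<in> carrier A; y \<in> carrier A; x \<sqsubseteq> y\<rbrakk> \<Longrightarrow> (y \<ominus> x) \<oplus> x = y"
  by (simp add: le_iff_minus flip: minus_plus_comm[of x y])

lemma le_plus [simp]: "\<lbrakk>x \<in> carrier A; y \<in> carrier A\<rbrakk> \<Longrightarrow> x \<sqsubseteq> x \<oplus> y"
  by (simp add: mv_le_def flip: plus_assoc)

lemma le_plus2 [simp]: "\<lbrakk>x \<in> carrier A; y \<in> carrier A\<rbrakk> \<Longrightarrow> x \<sqsubseteq> y \<oplus> x"
  by (simp add: plus_comm[of y])

lemma le_refl [simp]: "x \<in> carrier A \<Longrightarrow> x \<sqsubseteq> x"
  by (simp add: mv_le_def)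

lemma zero_le [simp]: "x \<in> carrier A \<Longrightarrow> \<zero> \<sqsubseteq> x"
  by (simp add: mv_le_def)

lemma le_one [simp]: "x \<in> carrier A \<Longrightarrow> x \<sqsubseteq> \<sim> \<zero>"
  by (simp add: mv_le_def)

lemma le_antisym: "\<lbrakk>x \<in> carrier A; y \<in> carrier A; x \<sqsubseteq> y; y \<sqsubseteq> x\<rbrakk> \<Longrightarrow> x = y"
  using minus_plus_cancel[of x y] by (simp add: le_iff_minus)

lemma le_trans:
  assumes "x \<in> carrier A" "y \<in> carrier A" "z \<in> carrier A" "x \<sqsubseteq> y" "y \<sqsubseteq> z"
  shows "x \<sqsubseteq> z"
proof -
  have "z = (z \<ominus> y) \<oplus> ((y \<ominus> x) \<oplus> x)"
    using assms by (simp add: minus_plus_cancel)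
  also have "\<dots> = ((z \<ominus> y) \<oplus> (y \<ominus> x)) \<oplus> x"
    using assms by (simp add: plus_assoc)
  finally show ?thesis
    using assms le_plus2[of x "(z \<ominus> y) \<oplus> (y \<ominus> x)"] by simp
qed

lemma neg_le_neg: "\<lbrakk>x \<in> carrier A; y \<in> carrier A\<rbrakk> \<Longrightarrow> \<sim> x \<sqsubseteq> \<sim> y \<longleftrightarrow> y \<sqsubseteq> x"
  by (simp add: mv_le_def plus_comm[of x])

text \<open>Residuation: truncated subtraction of \<open>y\<close> is adjoint to adding
  \<open>y\<close>. Later bounds on differences are reduced to bounds on sums this way.\<close>

lemma minus_le_iff:
  "\<lbrakk>x \<in> carrier A; y \<in> carrier A; z \<in> carrier A\<rbrakk> \<Longrightarrow> x \<ominus> y \<sqsubseteq> z \<longleftrightarrow> x \<sqsubseteq> y \<oplus> z"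
  by (simp add: mv_le_def mv_minus_def plus_assoc)

lemma plus_mono_left:
  assumes "x \<in> carrier A" "y \<in> carrier A" "z \<in> carrier A" "x \<sqsubseteq> y"
  shows "x \<oplus> z \<sqsubseteq> y \<oplus> z"
proof -
  have "y \<oplus> z = (y \<ominus> x) \<oplus> (x \<oplus> z)"
    using assms minus_plus_cancel[of x y] by (simp flip: plus_assoc)
  then show ?thesis
    using assms by simp
qed

lemma plus_mono:
  assumes "x \<in> carrier A" "y \<in> carrier A" "x' \<in> carrier A" "y' \<in> carrier A" "x \<sqsubseteq> x'" "y \<sqsubseteq> y'"
  shows "x \<oplus> y \<sqsubseteq> x' \<oplus> y'"
proof -
  have "x \<oplus> y \<sqsubseteq> x' \<oplus> y"
    using assms plus_mono_left by blast
  moreover have "x' \<oplus> y \<sqsubseteq> x' \<oplus> y'"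
    using assms plus_mono_left[of y y' x'] by (simp add: plus_comm[of x'])
  ultimately show ?thesis
    using assms le_trans[of "x \<oplus> y" "x' \<oplus> y" "x' \<oplus> y'"] by simp
qed

lemma minus_le [simp]: "\<lbrakk>x \<in> carrier A; y \<in> carrier A\<rbrakk> \<Longrightarrow> x \<ominus> y \<sqsubseteq> x"
  by (simp add: minus_le_iff)

lemma minus_le_neg: "\<lbrakk>x \<in> carrier A; y \<in> carrier A\<rbrakk> \<Longrightarrow> x \<ominus> y \<sqsubseteq> \<sim> y"
  by (simp add: minus_le_iff)

lemma minus_minus: "\<lbrakk>x \<in> carrier A; y \<in> carrier A; z \<in> carrier A\<rbrakk> \<Longrightarrow> x \<ominus> y \<ominus> z = x \<ominus> (y \<oplus> z)"
  by (simp add: mv_minus_def plus_assoc)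

lemma minus_mono_left:
  "\<lbrakk>x \<in> carrier A; y \<in> carrier A; z \<in> carrier A; x \<sqsubseteq> y\<rbrakk> \<Longrightarrow> x \<ominus> z \<sqsubseteq> y \<ominus> z"
  by (simp add: mv_minus_def neg_le_neg plus_mono)

lemma minus_anti_right:
  "\<lbrakk>x \<in> carrier A; y \<in> carrier A; z \<in> carrier A; x \<sqsubseteq> y\<rbrakk> \<Longrightarrow> z \<ominus> y \<sqsubseteq> z \<ominus> x"
  by (simp add: mv_minus_def neg_le_neg plus_mono)

lemma neg_minus_neg: "\<lbrakk>x \<in> carrier A; y \<in> carrier A\<rbrakk> \<Longrightarrow> \<sim> x \<ominus> \<sim> y = y \<ominus> x"
  by (simp add: mv_minus_def plus_comm)

lemma minus_self [simp]: "x \<in> carrier A \<Longrightarrow> x \<ominus> x = \<zero>"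
  by (simp add: mv_minus_def)

lemma zero_minus [simp]: "x \<in> carrier A \<Longrightarrow> \<zero> \<ominus> x = \<zero>"
  by (simp add: mv_minus_def)

lemma minus_zero [simp]: "x \<in> carrier A \<Longrightarrow> x \<ominus> \<zero> = x"
  by (simp add: mv_minus_def)

text \<open>The hypothesis says that \<open>x \<oplus> y\<close> does not overflow. The complement
  of the left side is the join of \<open>\<sim> x\<close> and \<open>y\<close>, and \<open>y\<close>
  already lies below \<open>\<sim> x\<close>.\<close>

lemma plus_minus_cancel:
  assumes "x \<in> carrier A" "y \<in> carrier A" "x \<sqsubseteq> \<sim> y"
  shows "(x \<oplus> y) \<ominus> y = x"
proof -
  have "y \<sqsubseteq> \<sim> x"
    using assms by (simp add: mv_le_def plus_comm)
  then have "(\<sim> x \<ominus> y) \<oplus> y = \<sim> x"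
    using assms minus_plus_cancel[of y "\<sim> x"] by simp
  then have "\<sim> ((x \<oplus> y) \<ominus> y) = \<sim> x"
    using assms by (simp add: mv_minus_def)
  then show ?thesis
    using assms by (simp add: neg_eq_iff)
qed

text \<open>Together with \<open>plus_minus_plus_le\<close>, this is why closeness modulo an ideal
  is a congruence.\<close>

lemma minus_triangle:
  assumes "x \<in> carrier A" "y \<in> carrier A" "z \<in> carrier A"
  shows "x \<ominus> z \<sqsubseteq> (x \<ominus> y) \<oplus> (y \<ominus> z)"
proof -
  have "x \<sqsubseteq> (x \<ominus> y) \<oplus> y"
    using assms by (simp add: plus_comm flip: minus_le_iff)
  moreover have "(x \<ominus> y) \<oplus> y \<sqsubseteq> (x \<ominus> y) \<oplus> ((y \<ominus> z) \<oplus> z)"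
    using assms by (intro plus_mono) (simp_all add: plus_comm flip: minus_le_iff)
  ultimately show ?thesis
    using assms le_trans[of x "(x \<ominus> y) \<oplus> y" "z \<oplus> ((x \<ominus> y) \<oplus> (y \<ominus> z))"]
    by (simp add: minus_le_iff plus_ac)
qed

lemma plus_minus_plus_le:
  assumes "x \<in> carrier A" "y \<in> carrier A" "x' \<in> carrier A" "y' \<in> carrier A"
  shows "(x \<oplus> y) \<ominus> (x' \<oplus> y') \<sqsubseteq> (x \<ominus> x') \<oplus> (y \<ominus> y')"
proof -
  have "x \<sqsubseteq> x' \<oplus> (x \<ominus> x')" "y \<sqsubseteq> y' \<oplus> (y \<ominus> y')"
    using assms by (simp_all flip: minus_le_iff)
  then have "x \<oplus> y \<sqsubseteq> (x' \<oplus> (x \<ominus> x')) \<oplus> (y' \<oplus> (y \<ominus> y'))"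
    using assms by (intro plus_mono) simp_all
  then show ?thesis
    using assms by (simp add: minus_le_iff plus_ac)
qed

text \<open>\<open>x \<ominus> (x \<ominus> y)\<close> is the meet of \<open>x\<close> and
  \<open>y\<close>. Applying antitonicity twice compares it with
  \<open>x \<ominus> (x \<ominus> z)\<close>, which is \<open>z\<close> because \<open>z\<close>
  lies below \<open>x\<close>.\<close>

lemma le_meet:
  assumes "x \<in> carrier A" "y \<in> carrier A" "z \<in> carrier A" "z \<sqsubseteq> x" "z \<sqsubseteq> y"
  shows "z \<sqsubseteq> x \<ominus> (x \<ominus> y)"
proof -
  have "x \<ominus> y \<sqsubseteq> x \<ominus> z"
    using assms by (simp add: minus_anti_right)
  then have "x \<ominus> (x \<ominus> z) \<sqsubseteq> x \<ominus> (x \<ominus> y)"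
    using assms by (simp add: minus_anti_right)
  moreover have "x \<ominus> (x \<ominus> z) = z"
    using assms plus_minus_cancel[of z "x \<ominus> z"] minus_plus_cancel[of z x] minus_le_neg[of x z]
    by (simp add: plus_comm mv_le_def)
  ultimately show ?thesis
    by simp
qed

text \<open>Adding \<open>z\<close> to the meet \<open>w\<close> of \<open>x\<close> and
  \<open>y\<close> gives an element still below both, hence below \<open>w\<close>. As this sum does
  not overflow, \<open>z\<close> can be cancelled to \<open>\<zero>\<close>.\<close>

lemma minus_disjoint:
  assumes x: "x \<in> carrier A" and y: "y \<in> carrier A" and z: "z \<in> carrier A"
    and "z \<sqsubseteq> x \<ominus> y" "z \<sqsubseteq> y \<ominus> x"
  shows "z = \<zero>"
proof -
  define w where "w = x \<ominus> (x \<ominus> y)"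
  have w: "w \<in> carrier A"
    using x y by (simp add: w_def)
  \<comment> \<open>The symmetry of joins, applied to the complements, makes the meet
    symmetric.\<close>
  have w': "w = y \<ominus> (y \<ominus> x)"
    using minus_plus_comm[of "\<sim> x" "\<sim> y"] x y
    by (simp add: w_def mv_minus_def plus_comm)
  have bound: "w \<sqsubseteq> u \<ominus> z \<and> w \<oplus> z \<sqsubseteq> u"
    if u: "u \<in> carrier A" "v \<in> carrier A" and "z \<sqsubseteq> u \<ominus> v" "w = u \<ominus> (u \<ominus> v)" for u v
  proof -
    have 1: "w \<sqsubseteq> u \<ominus> z"
      using that z by (simp add: minus_anti_right)
    have "z \<sqsubseteq> u"
      using le_trans[of z "u \<ominus> v" u] that z by simp
    then have "(u \<ominus> z) \<oplus> z = u"
      using minus_plus_cancel u z by simp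
    with 1 show ?thesis
      using plus_mono_left[of w "u \<ominus> z" z] w u z by simp
  qed
  have wx: "w \<sqsubseteq> x \<ominus> z" "w \<oplus> z \<sqsubseteq> x" and wy: "w \<oplus> z \<sqsubseteq> y"
    using bound[of x y] bound[of y x] assms w' w_def by blast+
  have wz: "w \<sqsubseteq> \<sim> z"
    using le_trans[of w "x \<ominus> z" "\<sim> z"] wx x z w by (simp add: minus_le_neg)
  then have zw: "z \<sqsubseteq> \<sim> w"
    using z w by (simp add: mv_le_def plus_comm)
  have "w \<oplus> z \<sqsubseteq> w"
    using le_meet[of x y "w \<oplus> z"] wx wy x y z w by (simp flip: w_def)
  then have "(w \<oplus> z) \<ominus> w = \<zero>"
    using w z by (simp add: le_iff_minus)
  moreover have "(w \<oplus> z) \<ominus> w = z"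
    using plus_minus_cancel[of z w] zw z w by (simp add: plus_comm)
  ultimately show ?thesis
    by simp
qed

text \<open>
  The ideal \<open>perp r\<close> replaces generated ideals in the proof that maximal congruences give chains:
  \<open>x \<ominus> y\<close> and \<open>y \<ominus> x\<close> annihilate each other, so no explicit multiples are needed.
\<close>

definition perp :: "'a \<Rightarrow> 'a set" where
  "perp r = {x \<in> carrier A. \<forall>z\<in>carrier A. z \<sqsubseteq> x \<longrightarrow> z \<sqsubseteq> r \<longrightarrow> z = \<zero>}"

lemma perp_carrier: "x \<in> perp r \<Longrightarrow> x \<in> carrier A"
  by (simp add: perp_def)

lemma perp_commute: "\<lbrakk>x \<in> perp r; r \<in> carrier A\<rbrakk> \<Longrightarrow> r \<in> perp x"
  by (simp add: perp_def)

lemma perp_self: "x \<in> perp x \<Longrightarrow> x = \<zero>"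
  by (simp add: perp_def)

lemma minus_perp: "\<lbrakk>x \<in> carrier A; y \<in> carrier A\<rbrakk> \<Longrightarrow> x \<ominus> y \<in> perp (y \<ominus> x)"
  unfolding perp_def using minus_disjoint[of x y] by auto

lemma zero_perp: "\<zero> \<in> perp r"
  by (auto simp: perp_def intro: le_antisym)

lemma perp_downward:
  "\<lbrakk>y \<in> perp r; x \<in> carrier A; x \<sqsubseteq> y\<rbrakk> \<Longrightarrow> x \<in> perp r"
  unfolding perp_def using le_trans[of _ x y] by blast

text \<open>If \<open>z\<close> lies below \<open>p \<oplus> q\<close> and \<open>r\<close>, then
  \<open>z \<ominus> p\<close> lies below \<open>q\<close> and \<open>r\<close>, so it vanishes.
  Thus \<open>z\<close> lies below \<open>p\<close>, and vanishes in turn.\<close>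

lemma perp_plus:
  assumes p: "p \<in> perp r" and q: "q \<in> perp r" and r: "r \<in> carrier A"
  shows "p \<oplus> q \<in> perp r"
proof -
  note c = p[THEN perp_carrier] q[THEN perp_carrier]
  have "z = \<zero>" if z: "z \<in> carrier A" "z \<sqsubseteq> p \<oplus> q" "z \<sqsubseteq> r" for z
  proof -
    have "z \<ominus> p \<sqsubseteq> q" "z \<ominus> p \<sqsubseteq> r"
      using c r z le_trans[of "z \<ominus> p" z r] by (simp_all add: minus_le_iff)
    then have "z \<sqsubseteq> p"
      using c q z by (simp add: le_iff_minus perp_def)
    with z p show ?thesis
      by (simp add: perp_def)
  qed
  with c show ?thesis
    by (simp add: perp_def)
qed

text \<open>Having both differences in the ideal \<open>perp r\<close> is a congruence. It contains
  \<open>R\<close>, whose differences vanish, and the new pair, since the value of \<open>p\<close>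
  lies in the ideal; so it contains all that follows from them.\<close>

lemma mv_cong_perp:
  assumes R: "R \<subseteq> mv_terms X \<times> mv_terms X" and h: "h \<in> X \<rightarrow> carrier A"
    and hR: "\<And>s t. (s, t) \<in> R \<Longrightarrow> mv_eval A h s = mv_eval A h t"
    and p: "p \<in> mv_terms X" "mv_eval A h p \<in> perp r" and r: "r \<in> carrier A"
    and "(s, t) \<in> mv_cong X (insert (p, MZero) R)"
  shows "mv_eval A h s \<ominus> mv_eval A h t \<in> perp r \<and> mv_eval A h t \<ominus> mv_eval A h s \<in> perp r"
proof -
  have eq: "mv_eval A h s \<ominus> mv_eval A h t \<in> perp r \<and> mv_eval A h t \<ominus> mv_eval A h s \<in> perp r"
    if "(s, t) \<in> mv_cong X R" for s t
    using mv_eval_cong[OF R h hR that] mv_cong_terms[OF R that] mv_eval_closed[OF h]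
    by (simp add: zero_perp)
  have terms: "s \<in> mv_terms X" "t \<in> mv_terms X"
    if "(s, t) \<in> mv_cong X (insert (p, MZero) R)" for s t
    using mv_cong_terms[OF _ that] R p(1) by simp_all
  show ?thesis
    using assms(7)
  proof induction
    case (rel s t)
    then show ?case
    proof (cases "(s, t) \<in> R")
      case True
      then show ?thesis
        by (intro eq mv_cong.rel)
    next
      case False
      with rel have "s = p" "t = MZero"
        by auto
      with p show ?thesis
        using mv_eval_closed[OF h p(1)] by (simp add: zero_perp)
    qed
  next
    case (trans s t u)
    have st: "s \<in> mv_terms X" "t \<in> mv_terms X" "u \<in> mv_terms X"
      using trans.hyps terms by blast+
    have "mv_eval A h x \<ominus> mv_eval A h z \<in> perp r"
      if "mv_eval A h x \<ominus> mv_eval A h y \<in> perp r" "mv_eval A h y \<ominus> mv_eval A h z \<in> perp r"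
        "x \<in> mv_terms X" "y \<in> mv_terms X" "z \<in> mv_terms X" for x y z
      by (intro perp_downward[OF perp_plus[OF that(1,2) r] _ minus_triangle] minus_closed
          mv_eval_closed[OF h] that)
    with trans.IH st show ?case
      by blast
  next
    case (plus s s' t t')
    have "s \<in> mv_terms X" "t \<in> mv_terms X" "s' \<in> mv_terms X" "t' \<in> mv_terms X"
      using plus.hyps terms by blast+
    note c = this[THEN mv_eval_closed[OF h]]
    have "(a \<oplus> b) \<ominus> (a' \<oplus> b') \<in> perp r"
      if "a \<ominus> a' \<in> perp r" "b \<ominus> b' \<in> perp r"
        "a \<in> carrier A" "b \<in> carrier A" "a' \<in> carrier A" "b' \<in> carrier A" for a b a' b'
      by (intro perp_downward[OF perp_plus[OF that(1,2) r] _ plus_minus_plus_le] minus_closed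
          plus_closed that)
    with plus.IH c show ?case
      by simp
  next
    case (neg s t)
    have "s \<in> mv_terms X" "t \<in> mv_terms X"
      using neg.hyps terms by blast+
    with neg.IH show ?case
      using mv_eval_closed[OF h] by (simp add: neg_minus_neg)
  \<comment> \<open>Symmetry swaps the two conjuncts. Reflexivity and the axioms hold without the
    additional relation, so \<open>eq\<close> applies.\<close>
  qed (blast | (rule eq, (rule mv_cong.intros; assumption)))+
qed

end

section \<open>Separation by chains\<close>

lemma mv_cong_mono:
  assumes "R \<subseteq> R'" "(s, t) \<in> mv_cong X R"
  shows "(s, t) \<in> mv_cong X R'"
  using assms(2)
  by induction (((rule mv_cong.intros; assumption) | rule mv_cong.rel, use assms(1) in blast)+)

text \<open>A derivation uses finitely many relations. At each rule with two premises the larger of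
  two members of the chain serves for both.\<close>

lemma mv_cong_Union_chain:
  assumes "(s, t) \<in> mv_cong X (\<Union>\<C>)" "\<C> \<noteq> {}" "subset.chain \<A> \<C>"
  shows "\<exists>R\<in>\<C>. (s, t) \<in> mv_cong X R"
proof -
  have join: "\<exists>R\<in>\<C>. (a, b) \<in> mv_cong X R \<and> (c, d) \<in> mv_cong X R"
    if ex: "\<exists>R\<in>\<C>. (a, b) \<in> mv_cong X R" "\<exists>R\<in>\<C>. (c, d) \<in> mv_cong X R" for a b c d
  proof -
    obtain R\<^sub>1 R\<^sub>2 where R: "R\<^sub>1 \<in> \<C>" "(a, b) \<in> mv_cong X R\<^sub>1" "R\<^sub>2 \<in> \<C>" "(c, d) \<in> mv_cong X R\<^sub>2"
      using ex by blast
    then have "R\<^sub>1 \<subseteq> R\<^sub>2 \<or> R\<^sub>2 \<subseteq> R\<^sub>1"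
      using assms(3) unfolding subset.chain_def by blast
    with R show ?thesis
      using mv_cong_mono by blast
  qed
  \<comment> \<open>Nonemptiness supplies a member for reflexivity and the axioms, which use no
    relation.\<close>
  obtain R\<^sub>0 where "R\<^sub>0 \<in> \<C>"
    using assms(2) by blast
  show ?thesis
    using assms(1)
  proof induction
    case (trans s t u)
    then show ?case
      using join[of s t t u] by (meson mv_cong.trans)
  next
    case (plus s s' t t')
    then show ?case
      using join[of s s' t t'] by (meson mv_cong.plus)
  next
    case (rel s t)
    then show ?case
      by (auto intro: mv_cong.rel)
  next
    case (sym s t)
    then show ?case
      by (meson mv_cong.sym)
  next
    case (neg s t)
    then show ?case
      by (meson mv_cong.neg)
  qed (rule bexI[OF _ \<open>R\<^sub>0 \<in> \<C>\<close>], (rule mv_cong.intros; assumption))+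
qed

text \<open>Zorn's lemma gives a maximal \<open>R'\<close>. Two incomparable elements would yield
  two nonzero differences annihilating each other; killing either one identifies \<open>s\<close>
  and \<open>t\<close>, which forces \<open>s\<close> and \<open>t\<close> to be identified
  already.\<close>

lemma mv_presented_chain_separating:
  assumes R: "R \<subseteq> mv_terms X \<times> mv_terms X" and s: "s \<in> mv_terms X" and t: "t \<in> mv_terms X"
    and st: "(s, t) \<notin> mv_cong X R"
  shows "\<exists>R'. R \<subseteq> R' \<and> R' \<subseteq> mv_terms X \<times> mv_terms X \<and> (s, t) \<notin> mv_cong X R' \<and>
    mv_algebra (mv_presented X R') \<and>
    (\<forall>x\<in>carrier (mv_presented X R'). \<forall>y\<in>carrier (mv_presented X R').
      x \<sqsubseteq>\<^bsub>mv_presented X R'\<^esub> y \<or> y \<sqsubseteq>\<^bsub>mv_presented X R'\<^esub> x)"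
proof -
  let ?S = "{R'. R \<subseteq> R' \<and> R' \<subseteq> mv_terms X \<times> mv_terms X \<and> (s, t) \<notin> mv_cong X R'}"
  have "\<exists>M\<in>?S. \<forall>Y\<in>?S. M \<subseteq> Y \<longrightarrow> Y = M"
  proof (rule subset_Zorn_nonempty)
    have "R \<in> ?S"
      using R st by simp
    then show "?S \<noteq> {}"
      by auto
    show "\<Union>\<C> \<in> ?S" if \<C>: "\<C> \<noteq> {}" "subset.chain ?S \<C>" for \<C>
    proof -
      have mem: "\<And>R'. R' \<in> \<C> \<Longrightarrow> R' \<in> ?S"
        using \<C>(2) unfolding subset.chain_def by blast
      then have "(s, t) \<notin> mv_cong X (\<Union>\<C>)"
        using mv_cong_Union_chain[OF _ \<C>] by blast
      moreover have "R \<subseteq> \<Union>\<C>"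
        using mem \<C>(1) by blast
      moreover have "\<Union>\<C> \<subseteq> mv_terms X \<times> mv_terms X"
        using mem by blast
      ultimately show ?thesis
        by simp
    qed
  qed
  then obtain R' where mem: "R' \<in> ?S" and max': "\<forall>Y\<in>?S. R' \<subseteq> Y \<longrightarrow> Y = R'"
    by (rule bexE)
  from mem have R': "R \<subseteq> R'" "R' \<subseteq> mv_terms X \<times> mv_terms X" "(s, t) \<notin> mv_cong X R'"
    by simp_all
  have max: "Y = R'"
    if Y: "R' \<subseteq> Y" "Y \<subseteq> mv_terms X \<times> mv_terms X" "(s, t) \<notin> mv_cong X Y" for Y
  proof -
    have "Y \<in> ?S"
      using Y R'(1) by simp
    with max' Y(1) show ?thesis
      by blast
  qed
  \<comment> \<open>If zero and one coincide, every term is congruent to one, in particular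
    \<open>s\<close> to \<open>t\<close>.\<close>
  have "(MZero, MNeg MZero) \<notin> mv_cong X R'"
  proof
    assume *: "(MZero, MNeg MZero) \<in> mv_cong X R'"
    have "(u, MNeg MZero) \<in> mv_cong X R'" if u: "u \<in> mv_terms X" for u
    proof -
      have "(u, MPlus u MZero) \<in> mv_cong X R'"
        using u by (intro mv_cong.sym[OF mv_cong.plus_zero])
      moreover have "(MPlus u MZero, MPlus u (MNeg MZero)) \<in> mv_cong X R'"
        using u * by (intro mv_cong.plus mv_cong.refl)
      ultimately show ?thesis
        using mv_cong.trans[OF _ mv_cong.trans[OF _ mv_cong.plus_neg_zero[OF u]]] by blast
    qed
    then show False
      using R'(3) mv_cong.trans[OF _ mv_cong.sym] s t by blast
  qed
  then interpret P: mv_algebra "mv_presented X R'"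
    using mv_presented_mv_algebra R'(2) by blast
  let ?P = "mv_presented X R'" and ?h = "\<lambda>x. mv_cong X R' `` {MVar x}"
  define e where "e = mv_eval ?P ?h"
  have h: "?h \<in> X \<rightarrow> carrier ?P"
    by (simp add: mv_class_carrier[OF R'(2)])
  have e: "e u = mv_cong X R' `` {u}" if "u \<in> mv_terms X" for u
    unfolding e_def using mv_eval_presented[OF R'(2) that] .
  have e_iff: "e u = e v \<longleftrightarrow> (u, v) \<in> mv_cong X R'" if "u \<in> mv_terms X" "v \<in> mv_terms X" for u v
    using that mv_class_eq_iff[OF R'(2)] by (simp add: e)
  have e_closed: "e u \<in> carrier ?P" if "u \<in> mv_terms X" for u
    unfolding e_def by (rule P.mv_eval_closed[OF h that])
  \<comment> \<open>Killing a nonzero \<open>e p\<close> properly enlarges \<open>R'\<close>, so by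
    maximality it identifies \<open>s\<close> and \<open>t\<close>. Their differences then lie in
    every ideal \<open>perp r\<close> that contains \<open>e p\<close>.\<close>
  have separate: "e s \<ominus>\<^bsub>?P\<^esub> e t \<in> P.perp r \<and> e t \<ominus>\<^bsub>?P\<^esub> e s \<in> P.perp r"
    if p: "p \<in> mv_terms X" "e p \<in> P.perp r" and r: "r \<in> carrier ?P" and "e p \<noteq> \<zero>\<^bsub>?P\<^esub>" for p r
  proof -
    have "(p, MZero) \<notin> R'"
      using that e_iff[OF p(1), of MZero] mv_cong.rel by (auto simp: e_def)
    then have "(s, t) \<in> mv_cong X (insert (p, MZero) R')"
      using max[of "insert (p, MZero) R'"] p(1) R'(2) by auto
    moreover have "e u = e v" if "(u, v) \<in> R'" for u v
      using that R'(2) e_iff[of u v] mv_cong.rel[OF that] by blast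
    ultimately show ?thesis
      using P.mv_cong_perp[OF R'(2) h _ p(1)] p(2) r unfolding e_def by blast
  qed
  have total: "e u \<sqsubseteq>\<^bsub>?P\<^esub> e v \<or> e v \<sqsubseteq>\<^bsub>?P\<^esub> e u" if uv: "u \<in> mv_terms X" "v \<in> mv_terms X" for u v
  proof (rule ccontr)
    define p where "p = MNeg (MPlus (MNeg u) v)"
    define q where "q = MNeg (MPlus (MNeg v) u)"
    have pq: "p \<in> mv_terms X" "q \<in> mv_terms X" "e p = e u \<ominus>\<^bsub>?P\<^esub> e v" "e q = e v \<ominus>\<^bsub>?P\<^esub> e u"
      using uv by (simp_all add: p_def q_def e_def mv_minus_def)
    assume "\<not> ?thesis"
    then have nz: "e p \<noteq> \<zero>\<^bsub>?P\<^esub>" "e q \<noteq> \<zero>\<^bsub>?P\<^esub>"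
      using uv e_closed by (auto simp: pq P.le_iff_minus)
    \<comment> \<open>First \<open>p\<close> is killed, which puts \<open>c\<close> into
      \<open>perp (e q)\<close>. By symmetry \<open>e q\<close> lies in \<open>perp c\<close>, so
      killing \<open>q\<close> puts \<open>c\<close> into \<open>perp c\<close>, whose only common
      element with \<open>c\<close> is \<open>\<zero>\<close>.\<close>
    have c: "c = \<zero>\<^bsub>?P\<^esub>" if c: "c \<in> {e s \<ominus>\<^bsub>?P\<^esub> e t, e t \<ominus>\<^bsub>?P\<^esub> e s}" for c
    proof -
      have cc: "c \<in> carrier ?P"
        using c s t e_closed by auto
      have "e p \<in> P.perp (e q)"
        using P.minus_perp e_closed uv by (simp add: pq)
      then have "c \<in> P.perp (e q)"
        using separate[of p "e q"] pq(1,2) nz c e_closed by blast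
      then have "e q \<in> P.perp c"
        using P.perp_commute e_closed pq(2) by blast
      then have "c \<in> P.perp c"
        using separate[of q c] pq(1,2) nz c cc by blast
      then show ?thesis
        by (rule P.perp_self)
    qed
    then have "e s = e t"
      by (intro P.le_antisym e_closed s t) (simp_all add: P.le_iff_minus e_closed s t)
    then show False
      using e_iff[OF s t] R'(3) by blast
  qed
  have "x \<sqsubseteq>\<^bsub>?P\<^esub> y \<or> y \<sqsubseteq>\<^bsub>?P\<^esub> x" if xy: "x \<in> carrier ?P" "y \<in> carrier ?P" for x y
  proof -
    obtain u v where "u \<in> mv_terms X" "x = e u" "v \<in> mv_terms X" "y = e v"
      using xy e unfolding mv_presented_carrier[OF R'(2)] by metis
    with total show ?thesis
      by blast
  qed
  with R' P.mv_algebra_axioms show ?thesis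
    by (intro exI[of _ R']) blast
qed

section \<open>Sums in a chain\<close>

lemma (in mv_algebra) minus_neg_commute:
  "\<lbrakk>x \<in> carrier A; y \<in> carrier A\<rbrakk> \<Longrightarrow> x \<ominus> \<sim> y = y \<ominus> \<sim> x"
  using neg_minus_neg[of "\<sim> x" y] by simp

text \<open>The element \<open>a \<ominus> \<sim> c\<close> is the remainder
  \<open>a + c - 1\<close> after a carry, so both sides stand for \<open>a + c + d - 1\<close>, cut
  off at one. Splitting \<open>\<sim> a\<close> off \<open>c\<close> and \<open>d\<close> makes the
  expression symmetric.\<close>

lemma (in mv_algebra) carry_plus_commute:
  assumes "a \<in> carrier A" "c \<in> carrier A" "d \<in> carrier A" "\<sim> a \<sqsubseteq> c" "\<sim> a \<sqsubseteq> d"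
  shows "(a \<ominus> \<sim> c) \<oplus> d = (a \<ominus> \<sim> d) \<oplus> c"
proof -
  have "(c \<ominus> \<sim> a) \<oplus> d = (c \<ominus> \<sim> a) \<oplus> ((d \<ominus> \<sim> a) \<oplus> \<sim> a)"
    using assms by (simp add: minus_plus_cancel)
  also have "\<dots> = (d \<ominus> \<sim> a) \<oplus> ((c \<ominus> \<sim> a) \<oplus> \<sim> a)"
    using assms by (simp add: plus_left_comm)
  also have "\<dots> = (d \<ominus> \<sim> a) \<oplus> c"
    using assms by (simp add: minus_plus_cancel)
  finally show ?thesis
    using assms by (simp add: minus_neg_commute[of a])
qed

text \<open>Dual to \<open>carry_plus_commute\<close>, by passing to the complements of
  \<open>a\<close>, \<open>c\<close> and \<open>d\<close>.\<close>

lemma (in mv_algebra) plus_carry_commute: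
  assumes "a \<in> carrier A" "c \<in> carrier A" "d \<in> carrier A" "a \<sqsubseteq> \<sim> c" "a \<sqsubseteq> \<sim> d"
  shows "(a \<oplus> c) \<ominus> \<sim> d = (a \<oplus> d) \<ominus> \<sim> c"
proof -
  have "(\<sim> a \<ominus> c) \<oplus> \<sim> d = (\<sim> a \<ominus> d) \<oplus> \<sim> c"
    using assms carry_plus_commute[of "\<sim> a" "\<sim> c" "\<sim> d"] by simp
  then show ?thesis
    using assms by (simp add: mv_minus_def)
qed

text \<open>The mixed case: \<open>c\<close> carries over \<open>a\<close> and \<open>d\<close> does
  not. Both sides equal \<open>c \<ominus> f\<close>, where \<open>f\<close> is the room
  \<open>1 - a - d\<close> left above \<open>a \<oplus> d\<close>.\<close>

lemma (in mv_algebra) carry_plus_eq_plus_carry: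
  assumes a: "a \<in> carrier A" and c: "c \<in> carrier A" and d: "d \<in> carrier A"
    and ac: "\<sim> a \<sqsubseteq> c" and ad: "a \<sqsubseteq> \<sim> d"
  shows "(a \<ominus> \<sim> c) \<oplus> d = (a \<oplus> d) \<ominus> \<sim> c"
proof -
  define f where "f = \<sim> a \<ominus> d"
  have f: "f \<in> carrier A"
    using a d by (simp add: f_def)
  have da: "d \<sqsubseteq> \<sim> a"
    using a d ad neg_le_neg[of "\<sim> d" a] by simp
  then have fd: "f \<oplus> d = \<sim> a"
    unfolding f_def using a d by (simp add: minus_plus_cancel)
  have "d \<sqsubseteq> \<sim> f"
    using minus_le_neg[of "\<sim> a" d] a d neg_le_neg[of "\<sim> f" d] f by (simp add: f_def)
  then have "(d \<oplus> f) \<ominus> f = d"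
    using d f by (simp add: plus_minus_cancel)
  moreover have "d \<oplus> f \<sqsubseteq> c"
    using fd ac d f by (simp add: plus_comm)
  ultimately have "d \<sqsubseteq> c \<ominus> f"
    using minus_mono_left[of "d \<oplus> f" c f] c d f by simp
  then have "(c \<ominus> f \<ominus> d) \<oplus> d = c \<ominus> f"
    using c d f by (simp add: minus_plus_cancel)
  then have "(c \<ominus> \<sim> a) \<oplus> d = c \<ominus> f"
    using c d f by (simp add: minus_minus fd)
  moreover have "\<sim> (a \<oplus> d) = f"
    using a d by (simp add: f_def mv_minus_def)
  ultimately show ?thesis
    using a c d by (simp add: minus_neg_commute[of a] minus_neg_commute[of "a \<oplus> d"])
qed

section \<open>Linearly ordered MV-algebras and addition with carry\<close>

locale mv_chain = mv_algebra +
  assumes total: "\<lbrakk>x \<in> carrier A; y \<in> carrier A\<rbrakk> \<Longrightarrow> x \<sqsubseteq> y \<or> y \<sqsubseteq> x"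
begin

lemma plus_eq_one_iff:
  "\<lbrakk>x \<in> carrier A; y \<in> carrier A\<rbrakk> \<Longrightarrow> x \<oplus> y = \<sim> \<zero> \<longleftrightarrow> \<sim> x \<sqsubseteq> y"
  by (simp add: mv_le_def)

lemma plus_neq_one_le:
  assumes "x \<in> carrier A" "y \<in> carrier A" "x \<oplus> y \<noteq> \<sim> \<zero>"
  shows "x \<sqsubseteq> \<sim> y"
  using assms total[of x "\<sim> y"] by (simp add: mv_le_def plus_comm)

lemma one_le_iff: "x \<in> carrier A \<Longrightarrow> \<sim> \<zero> \<sqsubseteq> x \<longleftrightarrow> x = \<sim> \<zero>"
  by (simp add: mv_le_def)

text \<open>
  A pair \<open>(n, a)\<close> with \<open>a \<noteq> \<sim> \<zero>\<close> stands for the element \<open>n + a\<close> of the ordered group whose unit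
  interval is \<open>A\<close>.
\<close>

fun add_elem :: "'a \<Rightarrow> nat \<times> 'a \<Rightarrow> nat \<times> 'a" where
  "add_elem c (n, a) =
     (if c \<in> carrier A \<and> a \<in> carrier A \<and> a \<noteq> \<sim> \<zero>
      then if a \<oplus> c = \<sim> \<zero> then (Suc n, a \<ominus> \<sim> c) else (n, a \<oplus> c)
      else (n, a))"

text \<open>The normal form: excluding the remainder one prevents \<open>(n, \<sim> \<zero>)\<close>
  and \<open>(Suc n, \<zero>)\<close> from both standing for \<open>n + 1\<close>.\<close>

definition proper :: "nat \<times> 'a \<Rightarrow> bool" where
  "proper s \<longleftrightarrow> snd s \<in> carrier A \<and> snd s \<noteq> \<sim> \<zero>"

lemma carry_neq_one:
  assumes "a \<in> carrier A" "c \<in> carrier A" "a \<noteq> \<sim> \<zero>"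
  shows "a \<ominus> \<sim> c \<noteq> \<sim> \<zero>"
  using assms by (metis minus_le neg_closed one_le_iff)

lemma add_elem_trivial: "c \<notin> carrier A \<or> \<not> proper s \<Longrightarrow> add_elem c s = s"
  by (cases s) (simp add: proper_def)

lemma proper_add_elem: "proper s \<Longrightarrow> proper (add_elem c s)"
  by (cases s) (auto simp: proper_def carry_neq_one)

text \<open>Exactly one carry occurs in either order: \<open>c\<close> carries at once or after
  \<open>d\<close>, while \<open>d\<close> never does.\<close>

lemma add_elem_commute_aux:
  assumes a: "a \<in> carrier A" "a \<noteq> \<sim> \<zero>" and c: "c \<in> carrier A" and d: "d \<in> carrier A"
    and "a \<oplus> c = \<sim> \<zero>" "a \<oplus> d \<noteq> \<sim> \<zero>"
  shows "add_elem d (add_elem c (n, a)) = add_elem c (add_elem d (n, a))"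
proof -
  have eq: "(a \<ominus> \<sim> c) \<oplus> d = (a \<oplus> d) \<ominus> \<sim> c"
    using assms plus_neq_one_le[of a d] plus_eq_one_iff[of a c] by (intro carry_plus_eq_plus_carry) blast+
  have "(a \<ominus> \<sim> c) \<oplus> d \<sqsubseteq> a \<oplus> d"
    using a c d by (simp add: plus_mono_left)
  then have ne: "(a \<ominus> \<sim> c) \<oplus> d \<noteq> \<sim> \<zero>"
    using assms(6) one_le_iff[of "a \<oplus> d"] a d by force
  have "(a \<oplus> d) \<oplus> c = (a \<oplus> c) \<oplus> d"
    using a c d by (simp add: plus_ac)
  then have "(a \<oplus> d) \<oplus> c = \<sim> \<zero>"
    using assms by simp
  then show ?thesis
    using assms eq ne carry_neq_one[of a c] by simp
qed

text \<open>Folding over multisets asks for commutation on all arguments. Elements outside the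
  carrier and improper pairs make \<open>add_elem\<close> trivial; the rest splits by whether
  \<open>c\<close> and \<open>d\<close> carry over \<open>a\<close>.\<close>

lemma add_elem_commute: "add_elem d (add_elem c s) = add_elem c (add_elem d s)"
proof (cases s)
  case s: (Pair n a)
  show ?thesis
  proof (cases "c \<in> carrier A \<and> d \<in> carrier A \<and> a \<in> carrier A \<and> a \<noteq> \<sim> \<zero>")
    case False
    then have "c \<notin> carrier A \<or> d \<notin> carrier A \<or> \<not> proper s"
      by (auto simp: s proper_def)
    then show ?thesis
      using add_elem_trivial by metis
  next
    case True
    then have c: "c \<in> carrier A" and d: "d \<in> carrier A" and a: "a \<in> carrier A" "a \<noteq> \<sim> \<zero>"
      by auto
    have assoc: "a \<oplus> c \<oplus> d = a \<oplus> d \<oplus> c"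
      using a c d by (simp add: plus_ac)
    consider "a \<oplus> c \<noteq> \<sim> \<zero>" "a \<oplus> d \<noteq> \<sim> \<zero>" | "a \<oplus> c = \<sim> \<zero>" "a \<oplus> d \<noteq> \<sim> \<zero>"
      | "a \<oplus> c \<noteq> \<sim> \<zero>" "a \<oplus> d = \<sim> \<zero>" | "a \<oplus> c = \<sim> \<zero>" "a \<oplus> d = \<sim> \<zero>"
      by blast
    then show ?thesis
    proof cases
      case 1
      then have "(a \<oplus> c) \<ominus> \<sim> d = (a \<oplus> d) \<ominus> \<sim> c"
        using a c d by (intro plus_carry_commute plus_neq_one_le)
      with 1 a c d assoc show ?thesis
        by (simp add: s)
    next
      case 2
      then show ?thesis
        unfolding s using a c d by (intro add_elem_commute_aux)
    next
      case 3
      then show ?thesis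
        unfolding s using a c d by (intro add_elem_commute_aux[symmetric])
    next
      case 4
      then have "(a \<ominus> \<sim> c) \<oplus> d = (a \<ominus> \<sim> d) \<oplus> c"
        using a c d by (intro carry_plus_commute) (simp_all only: plus_eq_one_iff)
      moreover have "a \<ominus> \<sim> c \<ominus> \<sim> d = a \<ominus> \<sim> d \<ominus> \<sim> c"
        using a c d by (simp add: minus_minus plus_comm)
      ultimately show ?thesis
        using 4 a c d carry_neq_one[of a] by (simp add: s)
    qed
  qed
qed

sublocale add_elem: comp_fun_commute add_elem
  by standard (rule ext, simp only: o_apply add_elem_commute)

section \<open>The lexicographic order on pairs and its translation invariance\<close>

fun less_pair :: "nat \<times> 'a \<Rightarrow> nat \<times> 'a \<Rightarrow> bool" where
  "less_pair (n, a) (m, b) \<longleftrightarrow> n < m \<or> n = m \<and> a \<sqsubseteq> b \<and> a \<noteq> b"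

lemma less_pair_total:
  assumes "proper s" "proper t"
  shows "less_pair s t \<or> s = t \<or> less_pair t s"
proof -
  obtain n a m b where "s = (n, a)" "t = (m, b)"
    by (metis surj_pair)
  moreover from this have "a \<sqsubseteq> b \<or> b \<sqsubseteq> a"
    using assms by (intro total) (simp_all add: proper_def)
  ultimately show ?thesis
    using linorder_less_linear[of n m] by auto
qed

lemma less_pair_irrefl: "\<not> less_pair s s"
  by (cases s) simp

lemma less_pair_trans:
  assumes "proper r" "proper s" "proper t" "less_pair r s" "less_pair s t"
  shows "less_pair r t"
proof -
  obtain k l m a b c where st: "r = (k, a)" "s = (l, b)" "t = (m, c)"
    by (metis surj_pair)
  with assms have abc: "a \<in> carrier A" "b \<in> carrier A" "c \<in> carrier A"
    by (simp_all add: proper_def)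
  have "a \<sqsubseteq> c \<and> a \<noteq> c" if "a \<sqsubseteq> b" "a \<noteq> b" "b \<sqsubseteq> c"
    using that abc le_trans[of a b c] le_antisym[of a b] by blast
  then show ?thesis
    using assms(4,5) unfolding st less_pair.simps by (meson less_trans)
qed

text \<open>For \<open>n < m\<close> the order is at risk only if the left side carries and the
  right does not; then the remainder is below \<open>c\<close>, hence below
  \<open>b \<oplus> c\<close>. For \<open>n = m\<close> a carry on the left forces one on the right,
  and cancellation keeps the inequality strict.\<close>

lemma add_elem_less:
  assumes st: "proper s" "proper t" "less_pair s t"
  shows "less_pair (add_elem c s) (add_elem c t)"
proof (cases "c \<in> carrier A")
  case False
  then show ?thesis
    using st by (simp add: add_elem_trivial)
next
  case c: True
  obtain n a m b where s: "s = (n, a)" and t: "t = (m, b)"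
    by (metis surj_pair)
  with st have ab: "a \<in> carrier A" "a \<noteq> \<sim> \<zero>" "b \<in> carrier A" "b \<noteq> \<sim> \<zero>"
    by (auto simp: proper_def)
  show ?thesis
  proof (cases "n < m")
    case True
    have "a \<ominus> \<sim> c \<sqsubseteq> b \<oplus> c \<and> a \<ominus> \<sim> c \<noteq> b \<oplus> c" if ac: "a \<oplus> c = \<sim> \<zero>"
    proof
      have le: "a \<ominus> \<sim> c \<sqsubseteq> c"
        using ab c by (simp add: minus_neg_commute[of a])
      then show "a \<ominus> \<sim> c \<sqsubseteq> b \<oplus> c"
        using le_trans[of "a \<ominus> \<sim> c" c "b \<oplus> c"] ab c by simp
      \<comment> \<open>Equality would squeeze the remainder to \<open>c\<close> itself. Cancelling
        \<open>c\<close> then gives \<open>\<sim> a = \<zero>\<close>, contrary to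
        properness.\<close>
      show "a \<ominus> \<sim> c \<noteq> b \<oplus> c"
      proof
        assume *: "a \<ominus> \<sim> c = b \<oplus> c"
        have "c \<sqsubseteq> b \<oplus> c"
          using ab c by simp
        then have "c = b \<oplus> c"
          using * le ab c by (intro le_antisym) simp_all
        then have "c \<ominus> \<sim> a = c"
          using * ab c by (simp add: minus_neg_commute[of a])
        moreover have "(c \<ominus> \<sim> a) \<oplus> \<sim> a = c"
          using ac ab c by (intro minus_plus_cancel) (simp_all flip: plus_eq_one_iff)
        ultimately have "c \<oplus> \<sim> a = c"
          by simp
        then have "(\<sim> a \<oplus> c) \<ominus> c = \<zero>"
          using ab c by (simp add: plus_comm)
        moreover have "\<sim> a \<sqsubseteq> \<sim> c"
          using minus_le_neg[of c "\<sim> a"] \<open>c \<ominus> \<sim> a = c\<close> ab c by (simp add: neg_le_neg)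
        ultimately have "\<sim> a = \<zero>"
          using plus_minus_cancel[of "\<sim> a" c] ab c by simp
        then show False
          using ab by (metis neg_neg)
      qed
    qed
    with True show ?thesis
      using ab c by (simp add: s t) linarith
  next
    case False
    then have nm: "m = n" and le: "a \<sqsubseteq> b" "a \<noteq> b"
      using st by (auto simp: s t)
    have "b \<oplus> c = \<sim> \<zero>" if "a \<oplus> c = \<sim> \<zero>"
      using plus_mono_left[of a b c] that le ab c one_le_iff[of "b \<oplus> c"] by simp
    moreover have "a \<oplus> c \<sqsubseteq> b \<oplus> c" "a \<oplus> c \<noteq> b \<oplus> c" if "b \<oplus> c \<noteq> \<sim> \<zero>" "a \<oplus> c \<noteq> \<sim> \<zero>"
    proof -
      show "a \<oplus> c \<sqsubseteq> b \<oplus> c"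
        using ab c le by (simp add: plus_mono_left)
      have "(a \<oplus> c) \<ominus> c = a" "(b \<oplus> c) \<ominus> c = b"
        using that ab c by (intro plus_minus_cancel plus_neq_one_le; simp)+
      with le show "a \<oplus> c \<noteq> b \<oplus> c"
        by metis
    qed
    moreover have "a \<ominus> \<sim> c \<sqsubseteq> b \<ominus> \<sim> c" "a \<ominus> \<sim> c \<noteq> b \<ominus> \<sim> c"
      if "a \<oplus> c = \<sim> \<zero>" "b \<oplus> c = \<sim> \<zero>"
    proof -
      show "a \<ominus> \<sim> c \<sqsubseteq> b \<ominus> \<sim> c"
        using ab c le by (simp add: minus_mono_left)
      have "(a \<ominus> \<sim> c) \<oplus> \<sim> c = a" "(b \<ominus> \<sim> c) \<oplus> \<sim> c = b"
        using that ab c by (intro minus_plus_cancel; simp add: mv_le_def plus_comm)+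
      with le show "a \<ominus> \<sim> c \<noteq> b \<ominus> \<sim> c"
        by metis
    qed
    ultimately show ?thesis
      using ab c by (simp add: s t nm)
  qed
qed

section \<open>The preorder on multisets given by their sums\<close>

definition msum :: "'a multiset \<Rightarrow> nat \<times> 'a" where
  "msum M = fold_mset add_elem (0, \<zero>) M"

definition msum_le :: "'a multiset \<Rightarrow> 'a multiset \<Rightarrow> bool" where
  "msum_le M N \<longleftrightarrow> \<not> less_pair (msum N) (msum M)"

lemma proper_fold: "proper s \<Longrightarrow> proper (fold_mset add_elem s K)"
  by (induction K) (simp_all add: proper_add_elem)

lemma proper_msum: "proper (msum M)"
  unfolding msum_def by (rule proper_fold) (simp add: proper_def zero_neq_one)

lemma fold_add_elem_less:
  assumes "proper s" "proper t" "less_pair s t"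
  shows "less_pair (fold_mset add_elem s K) (fold_mset add_elem t K)"
  by (induction K) (simp_all add: assms add_elem_less proper_fold)

lemma msum_plus_less:
  "less_pair (msum M) (msum N) \<Longrightarrow> less_pair (msum (M + K)) (msum (N + K))"
  using fold_add_elem_less[of "msum M" "msum N" K] proper_msum
  by (simp add: msum_def)

lemma msum_le_total: "msum_le M N \<or> msum_le N M"
  using less_pair_total[OF proper_msum proper_msum] less_pair_trans[OF proper_msum proper_msum proper_msum]
    less_pair_irrefl
  unfolding msum_le_def by metis

lemma msum_le_iff: "msum_le M N \<longleftrightarrow> less_pair (msum M) (msum N) \<or> msum M = msum N"
  using less_pair_total[OF proper_msum proper_msum] less_pair_trans[OF proper_msum proper_msum proper_msum]
    less_pair_irrefl
  unfolding msum_le_def by metis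

lemma msum_plus_eq: "msum M = msum N \<Longrightarrow> msum (M + K) = msum (N + K)"
  by (simp add: msum_def)

text \<open>\<open>M\<close> is replaced by \<open>N\<close> with \<open>K\<close> fixed, then
  \<open>K\<close> by \<open>L\<close> with \<open>N\<close> fixed. This and
  \<open>msum_le_plus_mono\<close> are hypotheses of
  \<open>multiset_preorder_weights\<close>.\<close>

lemma msum_less_plus_mono:
  assumes "\<not> msum_le N M" "msum_le K L"
  shows "\<not> msum_le (N + L) (M + K)"
proof -
  have 1: "less_pair (msum (M + K)) (msum (N + K))"
    using assms(1) msum_plus_less by (simp add: msum_le_def)
  have 2: "less_pair (msum (N + K)) (msum (N + L)) \<or> msum (N + K) = msum (N + L)"
    using assms(2) msum_plus_less[of K L N] msum_plus_eq[of K L N]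
    by (auto simp: msum_le_iff add.commute[of N])
  have "less_pair (msum (M + K)) (msum (N + L))"
    using 1 2 less_pair_trans[OF proper_msum proper_msum proper_msum] by metis
  then show ?thesis
    by (simp add: msum_le_def)
qed

lemma msum_le_plus_mono:
  assumes "msum_le M N" "msum_le K L"
  shows "msum_le (M + K) (N + L)"
proof (cases "msum_le N M")
  case False
  then show ?thesis
    using msum_less_plus_mono[OF False assms(2)] msum_le_total by blast
next
  case True
  then have "msum M = msum N"
    using assms(1) less_pair_trans[OF proper_msum proper_msum proper_msum] less_pair_irrefl
    unfolding msum_le_iff by metis
  then have "msum (M + K) = msum (N + K)"
    by (rule msum_plus_eq)
  moreover have "msum_le (N + K) (N + L)"
    using assms(2) msum_plus_less[of K L N] msum_plus_eq[of K L N]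
    by (auto simp: msum_le_iff add.commute[of N])
  ultimately show ?thesis
    by (simp add: msum_le_iff)
qed

end

section \<open>Fourier--Motzkin elimination\<close>

text \<open>Picks the value of one eliminated variable: the midpoint between the greatest lower and
  the least upper bound, or one step past the bounds if only one kind exists. The predicate
  \<open>s\<close> marks strict bounds.\<close>

lemma exists_between_bounds:
  fixes lo up :: "'i \<Rightarrow> 'b :: linordered_field"
  assumes "finite P" "finite N"
    and le: "\<And>i j. \<lbrakk>i \<in> P; j \<in> N\<rbrakk> \<Longrightarrow> lo i \<le> up j"
    and less: "\<And>i j. \<lbrakk>i \<in> P; j \<in> N; s i \<or> s j\<rbrakk> \<Longrightarrow> lo i < up j"
  shows "\<exists>c. (\<forall>i\<in>P. lo i \<le> c \<and> (s i \<longrightarrow> lo i < c)) \<and> (\<forall>j\<in>N. c \<le> up j \<and> (s j \<longrightarrow> c < up j))"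
proof -
  consider "P = {}" "N = {}" | "P = {}" "N \<noteq> {}" | "P \<noteq> {}" "N = {}" | "P \<noteq> {}" "N \<noteq> {}"
    by blast
  then show ?thesis
  proof cases
    case 1
    then show ?thesis
      by simp
  next
    case 2
    have "Min (up ` N) - 1 < up j" if "j \<in> N" for j
    proof -
      have "Min (up ` N) \<le> up j"
        using assms(2) that by simp
      then show ?thesis
        using less_add_one[of "up j"] by (simp add: diff_less_eq order.strict_trans1)
    qed
    with 2 show ?thesis
      by (intro exI[of _ "Min (up ` N) - 1"]) (auto intro: less_imp_le)
  next
    case 3
    have "lo i < Max (lo ` P) + 1" if "i \<in> P" for i
    proof -
      have "lo i \<le> Max (lo ` P)"
        using assms(1) that by simp
      then show ?thesis
        using less_add_one[of "Max (lo ` P)"] by (rule order.strict_trans1)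
    qed
    with 3 show ?thesis
      by (intro exI[of _ "Max (lo ` P) + 1"]) (auto intro: less_imp_le)
  next
    case 4
    define a b where "a = Max (lo ` P)" and "b = Min (up ` N)"
    obtain i\<^sub>0 where i\<^sub>0: "i\<^sub>0 \<in> P" "lo i\<^sub>0 = a"
      using Max_in[of "lo ` P"] 4 assms(1) unfolding a_def by fastforce
    obtain j\<^sub>0 where j\<^sub>0: "j\<^sub>0 \<in> N" "up j\<^sub>0 = b"
      using Min_in[of "up ` N"] 4 assms(2) unfolding b_def by fastforce
    have a: "lo i \<le> a" if "i \<in> P" for i
      using assms(1) that by (simp add: a_def)
    have b: "b \<le> up j" if "j \<in> N" for j
      using assms(2) that by (simp add: b_def)
    have ab: "a \<le> b"
      using le i\<^sub>0 j\<^sub>0 by auto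
    then have c: "a \<le> (a + b) / 2" "(a + b) / 2 \<le> b"
      by (simp_all add: field_simps)
    have "lo i < (a + b) / 2" if "i \<in> P" "s i" for i
    proof -
      have "lo i < b"
        using less[OF that(1) j\<^sub>0(1)] that(2) j\<^sub>0(2) by simp
      with a[OF that(1)] have "lo i + lo i < a + b"
        by (rule add_le_less_mono)
      then show ?thesis
        by (simp add: field_simps)
    qed
    moreover have "(a + b) / 2 < up j" if "j \<in> N" "s j" for j
    proof -
      have "a < up j"
        using less[OF i\<^sub>0(1) that(1)] that(2) i\<^sub>0(2) by simp
      then have "a + b < up j + up j"
        using b[OF that(1)] by (rule add_less_le_mono)
      then show ?thesis
        by (simp add: field_simps)
    qed
    ultimately show ?thesis
      using a b c by (intro exI[of _ "(a + b) / 2"]) (meson order_trans)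
  qed
qed

section \<open>Weights for finitely many members of a cone of integer linear forms\<close>

context
  fixes K :: "('v \<Rightarrow> int) set"
  assumes K_add: "\<And>l m. \<lbrakk>l \<in> K; m \<in> K\<rbrakk> \<Longrightarrow> (\<lambda>v. l v + m v) \<in> K"
begin

lemma cone_scale:
  assumes "l \<in> K" "0 < k"
  shows "(\<lambda>v. k * l v) \<in> K"
  using assms(2)
proof (induction rule: int_gr_induct)
  case base
  then show ?case
    using assms(1) by simp
next
  case (step k)
  then show ?case
    using K_add[OF assms(1) step.IH] by (simp add: algebra_simps)
qed

text \<open>Read backwards: strictness of \<open>l\<close> passes to its positive combinations.
  Adding \<open>j * m\<close> to the negated combination leaves \<open>- k * l\<close>, and
  \<open>k - 1\<close> copies of \<open>l\<close> reduce this to \<open>- l\<close>. The case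
  \<open>k = 1\<close> is separate because \<open>cone_scale\<close> needs a positive
  factor.\<close>

lemma cone_neg_of_combination:
  assumes l: "l \<in> K" and m: "m \<in> K" and k: "0 < k" "0 < j"
    and neg: "(\<lambda>v. - (k * l v + j * m v)) \<in> K"
  shows "(\<lambda>v. - l v) \<in> K"
proof -
  have kl: "(\<lambda>v. - (k * l v)) \<in> K"
    using K_add[OF neg cone_scale[OF m k(2)]] by simp
  show ?thesis
  proof (cases "k = 1")
    case True
    with kl show ?thesis
      by simp
  next
    case False
    with k have "0 < k - 1"
      by simp
    then show ?thesis
      using K_add[OF kl cone_scale[OF l, of "k - 1"]] by (simp add: algebra_simps)
  qed
qed

text \<open>Induction on the variables. Forms in \<open>K\<close> are to become nonnegative, and
  positive if their negative lies outside \<open>K\<close>. Lower and upper bounds on the weight of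
  \<open>x\<close> are compatible because the combinations cancelling \<open>x\<close> again belong
  to \<open>K\<close>.\<close>

lemma cone_weights:
  assumes "finite V" "finite L" "L \<subseteq> K" "\<And>l v. \<lbrakk>l \<in> L; v \<notin> V\<rbrakk> \<Longrightarrow> l v = 0"
  shows "\<exists>w :: 'v \<Rightarrow> rat. \<forall>l\<in>L. 0 \<le> (\<Sum>v\<in>V. of_int (l v) * w v) \<and>
    ((\<lambda>v. - l v) \<notin> K \<longrightarrow> 0 < (\<Sum>v\<in>V. of_int (l v) * w v))"
  using assms
proof (induction V arbitrary: L)
  case empty
  \<comment> \<open>Without variables each form is zero, so it equals its negative and no positivity
    is demanded.\<close>
  have "(\<lambda>v. - l v) \<in> K" if "l \<in> L" for l
  proof -
    have "l = (\<lambda>_. 0)"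
      using empty that by auto
    with that empty show ?thesis
      by auto
  qed
  then show ?case
    by auto
next
  case (insert x V)
  \<comment> \<open>For \<open>l\<close> in \<open>P\<close> and \<open>m\<close> in
    \<open>N\<close> both multipliers are positive, and the coefficient of \<open>x\<close>
    cancels.\<close>
  let ?comb = "\<lambda>(l :: 'v \<Rightarrow> int, m) v. (- m x) * l v + l x * m v"
  define P where "P = {l \<in> L. 0 < l x}"
  define N where "N = {l \<in> L. l x < 0}"
  define L' where "L' = {l \<in> L. l x = 0} \<union> ?comb ` (P \<times> N)"
  have PN: "finite P" "finite N"
    using insert.prems(1) by (simp_all add: P_def N_def)
  have "finite L'"
    using insert.prems(1) PN by (simp add: L'_def)
  moreover have "L' \<subseteq> K"
  proof
    fix h assume "h \<in> L'"
    then consider "h \<in> L" | l m where "l \<in> P" "m \<in> N" "h = ?comb (l, m)"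
      by (auto simp: L'_def)
    then show "h \<in> K"
    proof cases
      case 1
      then show ?thesis
        using insert.prems(2) by blast
    next
      case 2
      then have "l \<in> K" "m \<in> K" "0 < - m x" "0 < l x"
        using insert.prems(2) by (auto simp: P_def N_def)
      then show ?thesis
        unfolding 2(3) prod.case by (intro K_add cone_scale)
    qed
  qed
  moreover have "h v = 0" if "h \<in> L'" "v \<notin> V" for h v
  proof (cases "v = x")
    case True
    with that show ?thesis
      by (auto simp: L'_def)
  next
    case False
    then have zero: "l v = 0" if "l \<in> L" for l
      using insert.prems(3) that \<open>v \<notin> V\<close> by simp
    from that(1) consider "h \<in> L" | l m where "l \<in> P" "m \<in> N" "h = ?comb (l, m)"
      by (auto simp: L'_def)
    then show ?thesis
    proof cases
      case 2
      then have "l v = 0" "m v = 0"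
        by (simp_all add: P_def N_def zero)
      then show ?thesis
        by (simp add: 2(3))
    qed (rule zero)
  qed
  ultimately have "\<exists>w :: 'v \<Rightarrow> rat. \<forall>l\<in>L'. 0 \<le> (\<Sum>v\<in>V. of_int (l v) * w v) \<and>
    ((\<lambda>v. - l v) \<notin> K \<longrightarrow> 0 < (\<Sum>v\<in>V. of_int (l v) * w v))"
    by (rule insert.IH)
  then obtain w :: "'v \<Rightarrow> rat" where "\<forall>l\<in>L'. 0 \<le> (\<Sum>v\<in>V. of_int (l v) * w v) \<and>
    ((\<lambda>v. - l v) \<notin> K \<longrightarrow> 0 < (\<Sum>v\<in>V. of_int (l v) * w v))"
    by (rule exE)
  then have w: "\<And>l. l \<in> L' \<Longrightarrow> 0 \<le> (\<Sum>v\<in>V. of_int (l v) * w v)"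
      "\<And>l. \<lbrakk>l \<in> L'; (\<lambda>v. - l v) \<notin> K\<rbrakk> \<Longrightarrow> 0 < (\<Sum>v\<in>V. of_int (l v) * w v)"
    by simp_all
  define S where "S l = (\<Sum>v\<in>V. of_int (l v) * w v)" for l :: "'v \<Rightarrow> int"
  have comb: "S (?comb (l, m)) = of_int (- m x) * S l + of_int (l x) * S m" for l m
    by (simp add: S_def sum.distrib sum_distrib_left algebra_simps sum_subtractf sum_negf)
  \<comment> \<open>Forms in \<open>P\<close> bound the weight of \<open>x\<close> from below and
    forms in \<open>N\<close> from above; a pair of bounds compares as the inequality for
    \<open>?comb (l, m)\<close> divided by positive coefficients.\<close>
  have bounds: "- S l / of_int (l x) \<le> S m / of_int (- m x) \<and>
      ((\<lambda>v. - l v) \<notin> K \<or> (\<lambda>v. - m v) \<notin> K \<longrightarrow> - S l / of_int (l x) < S m / of_int (- m x))"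
    if lm: "l \<in> P" "m \<in> N" for l m
  proof -
    have pos: "0 < (of_int (l x) :: rat)" "0 < (of_int (- m x) :: rat)"
      using lm by (auto simp: P_def N_def)
    have lmK: "l \<in> K" "m \<in> K" "0 < - m x" "0 < l x"
      using lm insert.prems(2) by (auto simp: P_def N_def)
    have mem: "?comb (l, m) \<in> L'"
      using lm unfolding L'_def by blast
    have "(\<lambda>v. - ?comb (l, m) v) \<notin> K" if "(\<lambda>v. - l v) \<notin> K \<or> (\<lambda>v. - m v) \<notin> K"
    proof
      assume *: "(\<lambda>v. - ?comb (l, m) v) \<in> K"
      then have "(\<lambda>v. - l v) \<in> K"
        using cone_neg_of_combination[OF lmK] by simp
      moreover have "(\<lambda>v. - m v) \<in> K"
        using cone_neg_of_combination[OF lmK(2,1,4,3)] * by (simp add: add.commute)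
      ultimately show False
        using that by blast
    qed
    then have "0 \<le> of_int (- m x) * S l + of_int (l x) * S m"
      "(\<lambda>v. - l v) \<notin> K \<or> (\<lambda>v. - m v) \<notin> K \<Longrightarrow> 0 < of_int (- m x) * S l + of_int (l x) * S m"
      using w(1)[OF mem] w(2)[OF mem] comb[of l m] unfolding S_def by auto
    moreover have "- S l / of_int (l x) \<le> S m / of_int (- m x) \<longleftrightarrow>
        0 \<le> of_int (- m x) * S l + of_int (l x) * S m"
      "- S l / of_int (l x) < S m / of_int (- m x) \<longleftrightarrow>
        0 < of_int (- m x) * S l + of_int (l x) * S m"
      using pos by (simp_all add: field_simps)
    ultimately show ?thesis
      by blast
  qed
  define strict where "strict l \<longleftrightarrow> (\<lambda>v. - l v) \<notin> K" for l
  have "\<exists>c. (\<forall>l\<in>P. - S l / of_int (l x) \<le> c \<and> (strict l \<longrightarrow> - S l / of_int (l x) < c)) \<and>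
      (\<forall>l\<in>N. c \<le> S l / of_int (- l x) \<and> (strict l \<longrightarrow> c < S l / of_int (- l x)))"
    by (rule exists_between_bounds[OF PN]) (use bounds in \<open>simp_all only: strict_def\<close>)
  then obtain c where "(\<forall>l\<in>P. - S l / of_int (l x) \<le> c \<and> (strict l \<longrightarrow> - S l / of_int (l x) < c)) \<and>
      (\<forall>l\<in>N. c \<le> S l / of_int (- l x) \<and> (strict l \<longrightarrow> c < S l / of_int (- l x)))"
    by (rule exE)
  then have c: "\<And>l. l \<in> P \<Longrightarrow> - S l / of_int (l x) \<le> c"
      "\<And>l. \<lbrakk>l \<in> P; strict l\<rbrakk> \<Longrightarrow> - S l / of_int (l x) < c"
      "\<And>l. l \<in> N \<Longrightarrow> c \<le> S l / of_int (- l x)"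
      "\<And>l. \<lbrakk>l \<in> N; strict l\<rbrakk> \<Longrightarrow> c < S l / of_int (- l x)"
    by simp_all
  have sum_w: "(\<Sum>v\<in>insert x V. of_int (l v) * (w(x := c)) v) = of_int (l x) * c + S l" for l
  proof -
    have "(\<Sum>v\<in>V. of_int (l v) * (w(x := c)) v) = S l"
      unfolding S_def by (rule sum.cong) (use insert.hyps in auto)
    then show ?thesis
      using insert.hyps by simp
  qed
  have "0 \<le> of_int (l x) * c + S l \<and> (strict l \<longrightarrow> 0 < of_int (l x) * c + S l)"
    if l: "l \<in> L" for l
  proof -
    consider "l x = 0" | "l \<in> P" | "l \<in> N"
      using l linorder_less_linear[of "l x" 0] by (auto simp: P_def N_def)
    then show ?thesis
    proof cases
      case 1
      then have "l \<in> L'"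
        using l by (simp add: L'_def)
      with 1 w[of l] show ?thesis
        by (simp add: S_def strict_def)
    next
      case 2
      then have "0 < (of_int (l x) :: rat)"
        by (simp add: P_def)
      with c(1,2)[OF 2] show ?thesis
        by (auto simp: field_simps)
    next
      case 3
      then have "0 < (of_int (- l x) :: rat)"
        by (simp add: N_def)
      with c(3,4)[OF 3] show ?thesis
        by (auto simp: field_simps)
    qed
  qed
  then show ?case
    unfolding sum_w[symmetric] strict_def by blast
qed

end

text \<open>Elimination divides by coefficients, so its weights are rational; this makes them
  integral.\<close>

lemma common_denominator:
  fixes w :: "'v \<Rightarrow> rat"
  assumes "finite V"
  shows "\<exists>(d :: int) u. 0 < d \<and> (\<forall>v\<in>V. of_int d * w v = of_int (u v))"
  using assms
proof induction
  case empty
  show ?case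
    by (intro exI[of _ 1]) simp
next
  case (insert x V)
  then obtain d u where du: "0 < d" "\<forall>v\<in>V. of_int d * w v = of_int (u v)"
    by blast
  obtain a b where ab: "w x = of_int a / of_int b" "0 < b"
    by (cases "w x") (auto simp: Fract_of_int_quotient)
  have "of_int (d * b) * w v = of_int (((\<lambda>v. b * u v)(x := d * a)) v)" if "v \<in> insert x V" for v
  proof (cases "v = x")
    case True
    then show ?thesis
      using ab by simp
  next
    case False
    then have "of_int d * w v = of_int (u v)"
      using that du(2) by blast
    then show ?thesis
      using False by (simp add: algebra_simps)
  qed
  then show ?case
    using du(1) ab(2) by (meson mult_pos_pos)
qed

text \<open>Comparisons become linear forms, the differences of multiplicities. These form a cone by
  \<open>mono\<close>, and \<open>strict\<close> ensures that a strict comparison has its negated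
  form outside the cone.\<close>

lemma multiset_preorder_weights:
  fixes le :: "'v multiset \<Rightarrow> 'v multiset \<Rightarrow> bool"
  assumes total: "\<And>M N. le M N \<or> le N M"
    and mono: "\<And>M N K L. \<lbrakk>le M N; le K L\<rbrakk> \<Longrightarrow> le (M + K) (N + L)"
    and strict: "\<And>M N K L. \<lbrakk>\<not> le N M; le K L\<rbrakk> \<Longrightarrow> \<not> le (N + L) (M + K)"
    and "finite V" "finite P"
    and P: "\<And>M N. (M, N) \<in> P \<Longrightarrow> set_mset M \<subseteq> V \<and> set_mset N \<subseteq> V \<and> le M N"
  shows "\<exists>w :: 'v \<Rightarrow> int. \<forall>(M, N)\<in>P. (\<Sum>v\<in>#M. w v) \<le> (\<Sum>v\<in>#N. w v) \<and>
    (\<not> le N M \<longrightarrow> (\<Sum>v\<in>#M. w v) < (\<Sum>v\<in>#N. w v))"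
proof -
  define K where "K = {l. \<exists>A B. (\<forall>v. l v = int (count A v) - int (count B v)) \<and> le B A}"
  define diff where "diff = (\<lambda>(M, N) v. int (count N v) - int (count M (v :: 'v)))"
  have K_add: "(\<lambda>v. l v + m v) \<in> K" if lm: "l \<in> K" "m \<in> K" for l m
  proof -
    obtain A B A' B' where "\<forall>v. l v = int (count A v) - int (count B v)" "le B A"
      "\<forall>v. m v = int (count A' v) - int (count B' v)" "le B' A'"
      using lm unfolding K_def by blast
    then show ?thesis
      unfolding K_def using mono[of B A B' A']
      by (intro CollectI exI[of _ "A + A'"] exI[of _ "B + B'"]) simp
  qed
  have diff_K: "diff ` P \<subseteq> K"
    using P unfolding K_def diff_def by fast
  have neg_diff: "(\<lambda>v. - diff (M, N) v) \<notin> K" if MN: "\<not> le N M" for M N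
  proof
    assume "(\<lambda>v. - diff (M, N) v) \<in> K"
    then obtain A B where AB: "\<And>v. - diff (M, N) v = int (count A v) - int (count B v)" "le B A"
      unfolding K_def by blast
    \<comment> \<open>If \<open>B\<close> below \<open>A\<close> represented the negated form,
      adding it to the strict comparison of \<open>M\<close> and \<open>N\<close> would make a
      multiset strictly smaller than itself.\<close>
    have "M + B = N + A"
      using AB(1) by (intro multiset_eqI) (simp add: diff_def algebra_simps flip: of_nat_add)
    then show False
      using strict[OF MN AB(2)] total[of "N + A" "N + A"] by simp
  qed
  have "diff p v = 0" if "p \<in> P" "v \<notin> V" for p v
  proof -
    obtain M N where p: "p = (M, N)"
      by (cases p)
    with that P have "v \<notin># M" "v \<notin># N"
      by blast+
    then show ?thesis
      by (simp add: p diff_def not_in_iff)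
  qed
  then have supp: "l v = 0" if "l \<in> diff ` P" "v \<notin> V" for l v
    using that by blast
  have "\<exists>w :: 'v \<Rightarrow> rat. \<forall>l\<in>diff ` P. 0 \<le> (\<Sum>v\<in>V. of_int (l v) * w v) \<and>
    ((\<lambda>v. - l v) \<notin> K \<longrightarrow> 0 < (\<Sum>v\<in>V. of_int (l v) * w v))"
    by (rule cone_weights) (fact K_add \<open>finite V\<close> finite_imageI[OF \<open>finite P\<close>] diff_K supp)+
  then obtain w :: "'v \<Rightarrow> rat" where
    w: "\<And>p. p \<in> P \<Longrightarrow> 0 \<le> (\<Sum>v\<in>V. of_int (diff p v) * w v)"
       "\<And>p. \<lbrakk>p \<in> P; (\<lambda>v. - diff p v) \<notin> K\<rbrakk> \<Longrightarrow> 0 < (\<Sum>v\<in>V. of_int (diff p v) * w v)"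
    unfolding ball_simps by meson
  obtain d u where du: "0 < d" "\<And>v. v \<in> V \<Longrightarrow> of_int d * w v = of_int (u v)"
    using common_denominator[OF \<open>finite V\<close>, of w] by blast
  have count_sum: "(\<Sum>v\<in>V. int (count M v) * u v) = (\<Sum>v\<in>#M. u v)" if "set_mset M \<subseteq> V" for M
    using that
  proof (induction M)
    case (add x M)
    have "(\<Sum>v\<in>V. int (count (add_mset x M) v) * u v)
        = (\<Sum>v\<in>V. (if v = x then u v else 0) + int (count M v) * u v)"
      by (rule sum.cong) (auto simp: algebra_simps)
    also have "\<dots> = u x + (\<Sum>v\<in>V. int (count M v) * u v)"
      using add.prems \<open>finite V\<close> by (simp add: sum.distrib)
    finally show ?case
      using add by simp
  qed simp
  have scale: "of_int d * (\<Sum>v\<in>V. of_int (diff (M, N) v) * w v)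
      = (of_int ((\<Sum>v\<in>#N. u v) - (\<Sum>v\<in>#M. u v)) :: rat)" if "(M, N) \<in> P" for M N
  proof -
    have "of_int d * (\<Sum>v\<in>V. of_int (diff (M, N) v) * w v)
        = (\<Sum>v\<in>V. of_int (diff (M, N) v) * (of_int d * w v))"
      by (simp add: sum_distrib_left algebra_simps)
    also have "\<dots> = of_int (\<Sum>v\<in>V. diff (M, N) v * u v)"
      using du(2) by simp
    also have "(\<Sum>v\<in>V. diff (M, N) v * u v) = (\<Sum>v\<in>#N. u v) - (\<Sum>v\<in>#M. u v)"
      using P[OF that] by (simp add: diff_def left_diff_distrib sum_subtractf count_sum)
    finally show ?thesis .
  qed
  have d: "0 < (of_int d :: rat)"
    using du(1) by simp
  have "(\<Sum>v\<in>#M. u v) \<le> (\<Sum>v\<in>#N. u v) \<and> (\<not> le N M \<longrightarrow> (\<Sum>v\<in>#M. u v) < (\<Sum>v\<in>#N. u v))"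
    if MN: "(M, N) \<in> P" for M N
  proof (intro conjI impI)
    have "0 \<le> (of_int ((\<Sum>v\<in>#N. u v) - (\<Sum>v\<in>#M. u v)) :: rat)"
      unfolding scale[OF MN, symmetric] using d w(1)[OF MN] by simp
    then show "(\<Sum>v\<in>#M. u v) \<le> (\<Sum>v\<in>#N. u v)"
      by linarith
    assume "\<not> le N M"
    then have "0 < (of_int ((\<Sum>v\<in>#N. u v) - (\<Sum>v\<in>#M. u v)) :: rat)"
      unfolding scale[OF MN, symmetric] using d w(2)[OF MN neg_diff] by simp
    then show "(\<Sum>v\<in>#M. u v) < (\<Sum>v\<in>#N. u v)"
      by linarith
  qed
  then show ?thesis
    by (intro exI[of _ u]) blast
qed

section \<open>Finite chains\<close>

text \<open>The finite Lukasiewicz chain of multiples of \<open>1 / D\<close> in the unit interval,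
  scaled by \<open>D\<close> to natural numbers.\<close>

definition finite_chain :: "nat \<Rightarrow> nat mv" where
  "finite_chain D = \<lparr>carrier = {..D}, mv_zero = 0, mv_plus = (\<lambda>x y. min D (x + y)), mv_neg = (\<lambda>x. D - x)\<rparr>"

lemma finite_chain_simps [simp]:
  "carrier (finite_chain D) = {..D}"
  "\<zero>\<^bsub>finite_chain D\<^esub> = 0"
  "x \<oplus>\<^bsub>finite_chain D\<^esub> y = min D (x + y)"
  "\<sim>\<^bsub>finite_chain D\<^esub> x = D - x"
  by (simp_all add: finite_chain_def)

lemma mv_algebra_finite_chain:
  assumes "0 < D"
  shows "mv_algebra (finite_chain D)"
proof (rule mv_algebra.intro)
  show "comm_monoid \<lparr>carrier = carrier (finite_chain D), monoid.mult = (\<oplus>\<^bsub>finite_chain D\<^esub>),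
      one = \<zero>\<^bsub>finite_chain D\<^esub>\<rparr>"
    by (rule comm_monoidI) (auto simp: min_def)
  show "\<exists>x\<in>carrier (finite_chain D). \<exists>y\<in>carrier (finite_chain D). x \<noteq> y"
    using assms by (intro bexI[of _ 0] bexI[of _ D]) simp_all
qed (auto simp: min_def)

section \<open>Approximating a chain on finitely many elements by a finite chain\<close>

context mv_chain
begin

lemma msum_empty: "msum {#} = (0, \<zero>)"
  by (simp add: msum_def)

lemma msum_single: "x \<in> carrier A \<Longrightarrow> msum {#x#} = (if x = \<sim> \<zero> then (1, \<zero>) else (0, x))"
  using zero_neq_one by (simp add: msum_def)

lemma msum_pair:
  assumes "x \<in> carrier A" "y \<in> carrier A" "x \<noteq> \<sim> \<zero>"
  shows "msum {#x, y#} = (if x \<oplus> y = \<sim> \<zero> then (1, x \<ominus> \<sim> y) else (0, x \<oplus> y))"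
proof -
  have "msum {#x, y#} = add_elem y (msum {#x#})"
    by (simp add: msum_def add_mset_commute[of x y])
  then show ?thesis
    using assms by (simp add: msum_single)
qed

text \<open>The operations on \<open>V\<close> are determined by comparing sums of at most two
  elements. Weights preserving these comparisons respect the operations, with the weight of one as
  \<open>D\<close>.\<close>

lemma finite_chain_approximation:
  assumes V: "finite V" "V \<subseteq> carrier A" and ab: "a \<in> V" "b \<in> V" "a \<noteq> b"
  shows "\<exists>D (w :: 'a \<Rightarrow> nat). 0 < D \<and> (\<forall>x\<in>V. w x \<le> D) \<and> w \<zero> = 0 \<and>
    (\<forall>x\<in>V. \<forall>y\<in>V. x \<oplus> y \<in> V \<longrightarrow> w (x \<oplus> y) = min D (w x + w y)) \<and>
    (\<forall>x\<in>V. \<sim> x \<in> V \<longrightarrow> w (\<sim> x) = D - w x) \<and> w a \<noteq> w b"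
proof -
  \<comment> \<open>Zero and one are adjoined as reference points: their weights become
    \<open>0\<close> and \<open>D\<close>.\<close>
  define V' where "V' = insert \<zero> (insert (\<sim> \<zero>) V)"
  define F where "F = {{#}} \<union> (\<lambda>x. {#x#}) ` V' \<union> (\<lambda>(x, y). {#x, y#}) ` (V' \<times> V')"
  define P where "P = {(M, N) \<in> F \<times> F. msum_le M N}"
  have V': "finite V'" "V' \<subseteq> carrier A" "V \<subseteq> V'" "\<zero> \<in> V'" "\<sim> \<zero> \<in> V'"
    using V by (auto simp: V'_def)
  have F: "{#} \<in> F" "\<And>x. x \<in> V' \<Longrightarrow> {#x#} \<in> F" "\<And>x y. \<lbrakk>x \<in> V'; y \<in> V'\<rbrakk> \<Longrightarrow> {#x, y#} \<in> F"
    unfolding F_def by (simp_all add: image_iff, blast)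
  have "finite F"
    using V' by (simp add: F_def)
  then have "finite P"
    by (intro finite_subset[of P "F \<times> F"]) (auto simp: P_def)
  have F_sub: "set_mset M \<subseteq> V'" if "M \<in> F" for M
    using that by (auto simp: F_def)
  have P_sub: "set_mset M \<subseteq> V' \<and> set_mset N \<subseteq> V' \<and> msum_le M N" if "(M, N) \<in> P" for M N
    using that F_sub by (simp add: P_def)
  have "\<exists>w :: 'a \<Rightarrow> int. \<forall>(M, N)\<in>P. (\<Sum>v\<in>#M. w v) \<le> (\<Sum>v\<in>#N. w v) \<and>
      (\<not> msum_le N M \<longrightarrow> (\<Sum>v\<in>#M. w v) < (\<Sum>v\<in>#N. w v))"
    by (rule multiset_preorder_weights)
      (fact msum_le_total msum_le_plus_mono msum_less_plus_mono V'(1) \<open>finite P\<close> P_sub)+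
  then obtain w :: "'a \<Rightarrow> int" where "\<forall>(M, N)\<in>P. (\<Sum>v\<in>#M. w v) \<le> (\<Sum>v\<in>#N. w v) \<and>
      (\<not> msum_le N M \<longrightarrow> (\<Sum>v\<in>#M. w v) < (\<Sum>v\<in>#N. w v))"
    by (rule exE)
  then have w: "\<And>M N. (M, N) \<in> P \<Longrightarrow> (\<Sum>v\<in>#M. w v) \<le> (\<Sum>v\<in>#N. w v)"
       "\<And>M N. \<lbrakk>(M, N) \<in> P; \<not> msum_le N M\<rbrakk> \<Longrightarrow> (\<Sum>v\<in>#M. w v) < (\<Sum>v\<in>#N. w v)"
    by blast+
  have le: "(\<Sum>v\<in>#M. w v) \<le> (\<Sum>v\<in>#N. w v)" if "M \<in> F" "N \<in> F" "msum_le M N" for M N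
    by (rule w(1)) (use that in \<open>simp add: P_def\<close>)
  have less: "(\<Sum>v\<in>#M. w v) < (\<Sum>v\<in>#N. w v)" if "M \<in> F" "N \<in> F" "\<not> msum_le N M" for M N
    by (rule w(2)) (use that msum_le_total[of M N] in \<open>auto simp: P_def\<close>)
  have eq: "(\<Sum>v\<in>#M. w v) = (\<Sum>v\<in>#N. w v)" if "M \<in> F" "N \<in> F" "msum M = msum N" for M N
    using le[OF that(1,2)] le[OF that(2,1)] that(3) less_pair_irrefl by (simp add: msum_le_def)
  have zero: "w \<zero> = 0"
    using eq[OF F(2)[OF V'(4)] F(1)] V'(2,4) zero_neq_one by (simp add: msum_empty msum_single)
  have one: "0 < w (\<sim> \<zero>)"
    using less[OF F(1) F(2)[OF V'(5)]] by (simp add: msum_le_def msum_empty msum_single)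
  have nonneg: "0 \<le> w x" if x: "x \<in> V'" for x
  proof -
    have xA: "x \<in> carrier A"
      using x V'(2) by blast
    have "\<not> less_pair (msum {#x#}) (msum {#})"
      using xA le_antisym[of x \<zero>] by (auto simp: msum_empty msum_single)
    then show ?thesis
      using le[OF F(1) F(2)[OF x]] by (simp add: msum_le_def)
  qed
  have le_one: "w x \<le> w (\<sim> \<zero>)" if x: "x \<in> V'" for x
  proof -
    have xA: "x \<in> carrier A"
      using x V'(2) by blast
    have "\<not> less_pair (msum {#\<sim> \<zero>#}) (msum {#x#})"
      using xA by (simp add: msum_single)
    then show ?thesis
      using le[OF F(2)[OF x] F(2)[OF V'(5)]] by (simp add: msum_le_def)
  qed
  \<comment> \<open>Overflow of \<open>x \<oplus> y\<close> puts the sum of \<open>{#x, y#}\<close>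
    at or above that of \<open>{#\<sim> \<zero>#}\<close>; without overflow it is the sum of
    \<open>{#x \<oplus> y#}\<close>.\<close>
  have plus: "w (x \<oplus> y) = min (w (\<sim> \<zero>)) (w x + w y)" if xy: "x \<in> V'" "y \<in> V'" "x \<oplus> y \<in> V'" for x y
  proof -
    have xyA: "x \<in> carrier A" "y \<in> carrier A"
      using xy V'(2) by blast+
    consider "x = \<sim> \<zero>" | "x \<noteq> \<sim> \<zero>" "x \<oplus> y = \<sim> \<zero>" | "x \<noteq> \<sim> \<zero>" "x \<oplus> y \<noteq> \<sim> \<zero>"
      by blast
    then show ?thesis
    proof cases
      case 1
      then show ?thesis
        using nonneg[OF xy(2)] xyA by simp
    next
      case 2
      have "\<not> less_pair (msum {#x, y#}) (msum {#\<sim> \<zero>#})"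
        using 2 xyA le_antisym[of "x \<ominus> \<sim> y" \<zero>] by (auto simp: msum_pair msum_single)
      then have "w (\<sim> \<zero>) \<le> w x + w y"
        using le[OF F(2)[OF V'(5)] F(3)[OF xy(1,2)]] by (simp add: msum_le_def)
      with 2 show ?thesis
        by simp
    next
      case 3
      then have "w (x \<oplus> y) = w x + w y"
        using eq[OF F(2)[OF xy(3)] F(3)[OF xy(1,2)]] xyA by (simp add: msum_pair msum_single)
      with le_one[OF xy(3)] show ?thesis
        by simp
    qed
  qed
  \<comment> \<open>Adding \<open>x\<close> and \<open>\<sim> x\<close> carries once and leaves
    \<open>\<zero>\<close>, just as \<open>{#\<sim> \<zero>#}\<close> does.\<close>
  have neg: "w (\<sim> x) = w (\<sim> \<zero>) - w x" if x: "x \<in> V'" "\<sim> x \<in> V'" for x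
  proof -
    have xA: "x \<in> carrier A"
      using x V'(2) by blast
    show ?thesis
    proof (cases "x = \<sim> \<zero>")
      case True
      then show ?thesis
        using zero by simp
    next
      case False
      then show ?thesis
        using eq[OF F(2)[OF V'(5)] F(3)[OF x]] xA by (simp add: msum_pair msum_single)
    qed
  qed
  have ab': "w a \<noteq> w b"
  proof -
    have V: "a \<in> V'" "b \<in> V'" "a \<in> carrier A" "b \<in> carrier A"
      using ab V'(2,3) by auto
    have "msum {#a#} \<noteq> msum {#b#}"
      using V ab(3) by (auto simp: msum_single)
    then have "\<not> msum_le {#a#} {#b#} \<or> \<not> msum_le {#b#} {#a#}"
      using less_pair_total[OF proper_msum proper_msum] unfolding msum_le_def by blast
    then show ?thesis
      using less[OF F(2)[OF V(1)] F(2)[OF V(2)]] less[OF F(2)[OF V(2)] F(2)[OF V(1)]] by auto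
  qed
  show ?thesis
  \<comment> \<open>Passing to \<open>nat\<close> loses nothing, since the weights are nonnegative
    on \<open>V'\<close>.\<close>
  proof (intro exI[of _ "nat (w (\<sim> \<zero>))"] exI[of _ "\<lambda>x. nat (w x)"] conjI ballI impI)
    show "nat (w (x \<oplus> y)) = min (nat (w (\<sim> \<zero>))) (nat (w x) + nat (w y))"
      if "x \<in> V" "y \<in> V" "x \<oplus> y \<in> V" for x y
    proof -
      have "x \<in> V'" "y \<in> V'" "x \<oplus> y \<in> V'"
        using that V'(3) by blast+
      then show ?thesis
        using plus[of x y] nonneg[of x] nonneg[of y] by (simp add: min_def nat_add_distrib)
    qed
    show "nat (w (\<sim> x)) = nat (w (\<sim> \<zero>)) - nat (w x)" if "x \<in> V" "\<sim> x \<in> V" for x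
    proof -
      have "x \<in> V'" "\<sim> x \<in> V'"
        using that V'(3) by blast+
      then show ?thesis
        using neg[of x] nonneg[of x] by (simp add: nat_diff_distrib')
    qed
    show "nat (w x) \<le> nat (w (\<sim> \<zero>))" if "x \<in> V" for x
      using le_one[of x] that V'(3) by (intro nat_mono) blast
    have "a \<in> V'" "b \<in> V'"
      using ab V'(3) by blast+
    then show "nat (w a) \<noteq> nat (w b)"
      using ab' nonneg[of a] nonneg[of b] by simp
  qed (simp_all add: zero one)
qed

end

section \<open>Separation of presented algebras by finite chains\<close>

primrec mv_subterms :: "'v mv_term \<Rightarrow> 'v mv_term set" where
  "mv_subterms (MVar x) = {MVar x}"
| "mv_subterms MZero = {MZero}"
| "mv_subterms (MPlus s t) = insert (MPlus s t) (mv_subterms s \<union> mv_subterms t)"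
| "mv_subterms (MNeg t) = insert (MNeg t) (mv_subterms t)"

lemma finite_mv_subterms: "finite (mv_subterms t)"
  by (induction t) simp_all

lemma mv_subterms_self: "t \<in> mv_subterms t"
  by (cases t) simp_all

lemma mv_subterms_terms: "t \<in> mv_terms X \<Longrightarrow> mv_subterms t \<subseteq> mv_terms X"
  by (induction t) simp_all

text \<open>Evaluating \<open>s\<close>, \<open>t\<close> and the relations involves only the
  classes of their subterms. The approximation respects the operations there, so each such term
  evaluates to the weight of its class.\<close>

theorem mv_presented_separated:
  assumes R: "R \<subseteq> mv_terms X \<times> mv_terms X" "finite R"
    and s: "s \<in> mv_terms X" and t: "t \<in> mv_terms X" and st: "(s, t) \<notin> mv_cong X R"
  obtains D h where "0 < D" "h \<in> X \<rightarrow> {..D}"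
    and "\<And>p q. (p, q) \<in> R \<Longrightarrow> mv_eval (finite_chain D) h p = mv_eval (finite_chain D) h q"
    and "mv_eval (finite_chain D) h s \<noteq> mv_eval (finite_chain D) h t"
proof -
  obtain R' where R': "R \<subseteq> R'" "R' \<subseteq> mv_terms X \<times> mv_terms X" "(s, t) \<notin> mv_cong X R'"
    and alg: "mv_algebra (mv_presented X R')"
    and total: "\<And>x y. \<lbrakk>x \<in> carrier (mv_presented X R'); y \<in> carrier (mv_presented X R')\<rbrakk> \<Longrightarrow>
      x \<sqsubseteq>\<^bsub>mv_presented X R'\<^esub> y \<or> y \<sqsubseteq>\<^bsub>mv_presented X R'\<^esub> x"
    using mv_presented_chain_separating[OF R(1) s t st] by blast
  let ?C = "mv_presented X R'"
  interpret C: mv_chain ?C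
    by (rule mv_chain.intro[OF alg], unfold_locales) (rule total)
  define e where "e u = mv_cong X R' `` {u}" for u
  \<comment> \<open>Finite because \<open>R\<close> is; containing all subterms lets the evaluation
    be followed by induction.\<close>
  define T where "T = (\<Union>u\<in>insert s (insert t (fst ` R \<union> snd ` R)). mv_subterms u)"
  have T_terms: "T \<subseteq> mv_terms X"
    using mv_subterms_terms R(1) s t unfolding T_def by fastforce
  have "finite T"
    using R(2) by (simp add: T_def finite_mv_subterms)
  have T_root: "mv_subterms u \<subseteq> T" if "u = s \<or> u = t \<or> (\<exists>p. (u, p) \<in> R \<or> (p, u) \<in> R)" for u
    using that unfolding T_def by force
  have e_carrier: "e u \<in> carrier ?C" if "u \<in> T" for u
    using that T_terms mv_class_carrier[OF R'(2)] unfolding e_def by blast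
  have e_eq: "e u = e v \<longleftrightarrow> (u, v) \<in> mv_cong X R'" if "u \<in> mv_terms X" "v \<in> mv_terms X" for u v
    using mv_class_eq_iff[OF R'(2) that] unfolding e_def .
  have st_T: "s \<in> T" "t \<in> T"
    using T_root mv_subterms_self by blast+
  have eT: "finite (e ` T)" "e ` T \<subseteq> carrier ?C" "e s \<in> e ` T" "e t \<in> e ` T" "e s \<noteq> e t"
    using \<open>finite T\<close> e_carrier st_T e_eq[OF s t] R'(3) by auto
  obtain D :: nat and w where D: "0 < D"
    and w_le: "\<forall>x\<in>e ` T. w x \<le> D"
    and w_zero: "w \<zero>\<^bsub>?C\<^esub> = 0"
    and w_plus: "\<forall>x\<in>e ` T. \<forall>y\<in>e ` T. x \<oplus>\<^bsub>?C\<^esub> y \<in> e ` T \<longrightarrow> w (x \<oplus>\<^bsub>?C\<^esub> y) = min D (w x + w y)"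
    and w_neg: "\<forall>x\<in>e ` T. \<sim>\<^bsub>?C\<^esub> x \<in> e ` T \<longrightarrow> w (\<sim>\<^bsub>?C\<^esub> x) = D - w x"
    and w_st: "w (e s) \<noteq> w (e t)"
    using C.finite_chain_approximation[OF eT] by blast
  \<comment> \<open>The default \<open>0\<close> keeps \<open>h\<close> within \<open>{..D}\<close>
    on variables that do not occur in \<open>T\<close>.\<close>
  define h where "h x = (if MVar x \<in> T then w (e (MVar x)) else 0)" for x
  have eval: "mv_eval (finite_chain D) h u = w (e u)" if "mv_subterms u \<subseteq> T" for u
    using that
  proof (induction u)
    case (MVar x)
    then show ?case
      by (simp add: h_def)
  next
    case MZero
    then show ?case
      using w_zero mv_presented_zero[OF R'(2)] by (simp add: e_def)
  next
    case (MPlus u v)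
    then have T: "u \<in> T" "v \<in> T" "MPlus u v \<in> T"
      using mv_subterms_self by (auto intro: subsetD)
    then have "u \<in> mv_terms X" "v \<in> mv_terms X"
      using T_terms by blast+
    then have "e u \<oplus>\<^bsub>?C\<^esub> e v = e (MPlus u v)"
      unfolding e_def by (rule mv_presented_plus[OF R'(2)])
    then show ?case
      using MPlus T w_plus by force
  next
    case (MNeg u)
    then have T: "u \<in> T" "MNeg u \<in> T"
      using mv_subterms_self by (auto intro: subsetD)
    then have "u \<in> mv_terms X"
      using T_terms by blast
    then have "\<sim>\<^bsub>?C\<^esub> e u = e (MNeg u)"
      unfolding e_def by (rule mv_presented_neg[OF R'(2)])
    then show ?case
      using MNeg T w_neg by force
  qed
  show ?thesis
  proof (rule that[OF D])
    show "h \<in> X \<rightarrow> {..D}"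
      using w_le by (auto simp: h_def)
    show "mv_eval (finite_chain D) h p = mv_eval (finite_chain D) h q" if pq: "(p, q) \<in> R" for p q
    proof -
      have "(p, q) \<in> mv_cong X R'"
        using pq R'(1) by (blast intro: mv_cong.rel)
      then have "e p = e q"
        using e_eq pq R(1) by blast
      moreover have "mv_subterms p \<subseteq> T" "mv_subterms q \<subseteq> T"
        using T_root pq by blast+
      ultimately show ?thesis
        by (simp add: eval)
    qed
    show "mv_eval (finite_chain D) h s \<noteq> mv_eval (finite_chain D) h t"
      using w_st T_root by (simp add: eval)
  qed
qed

section \<open>Residual finiteness and the hopfian property\<close>

text \<open>Residual finiteness, with finite chains as the test algebras.\<close>

definition mv_separated :: "'a mv \<Rightarrow> bool" where
  "mv_separated A \<longleftrightarrow> (\<forall>x\<in>carrier A. \<forall>y\<in>carrier A. x \<noteq> y \<longrightarrow>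
     (\<exists>D>0. \<exists>h\<in>mv_hom A (finite_chain D). h x \<noteq> h y))"

lemma mv_hom_carrier: "f \<in> mv_hom A B \<Longrightarrow> x \<in> carrier A \<Longrightarrow> f x \<in> carrier B"
  by (auto simp: mv_hom_def)

lemma mv_hom_comp: "f \<in> mv_hom A B \<Longrightarrow> g \<in> mv_hom B C \<Longrightarrow> g \<circ> f \<in> mv_hom A C"
  by (auto simp: mv_hom_def Pi_iff)

lemma mv_hom_funpow: "f \<in> mv_hom A A \<Longrightarrow> f ^^ n \<in> mv_hom A A"
  by (induction n) (simp_all add: mv_hom_comp, simp add: mv_hom_def)

lemma mv_separated_presented:
  assumes "R \<subseteq> mv_terms X \<times> mv_terms X" "finite R"
  shows "mv_separated (mv_presented X R)"
  unfolding mv_separated_def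
proof (intro ballI impI)
  fix x y assume xy: "x \<in> carrier (mv_presented X R)" "y \<in> carrier (mv_presented X R)" "x \<noteq> y"
  then obtain s t where s: "s \<in> mv_terms X" "x = mv_cong X R `` {s}"
    and t: "t \<in> mv_terms X" "y = mv_cong X R `` {t}"
    unfolding mv_presented_carrier[OF assms(1)] by blast
  then have "(s, t) \<notin> mv_cong X R"
    using xy(3) mv_class_eq_iff[OF assms(1) s(1) t(1)] by blast
  from mv_presented_separated[OF assms s(1) t(1) this]
  obtain D h where D: "0 < D" and h: "h \<in> X \<rightarrow> {..D}"
    and R: "\<And>p q. (p, q) \<in> R \<Longrightarrow> mv_eval (finite_chain D) h p = mv_eval (finite_chain D) h q"
    and st: "mv_eval (finite_chain D) h s \<noteq> mv_eval (finite_chain D) h t"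
    by metis
  have "h \<in> X \<rightarrow> carrier (finite_chain D)"
    using h by simp
  from mv_presented_hom[OF mv_algebra_finite_chain[OF D] assms(1) this R]
  obtain g where "g \<in> mv_hom (mv_presented X R) (finite_chain D)"
    "\<And>u. u \<in> mv_terms X \<Longrightarrow> g (mv_cong X R `` {u}) = mv_eval (finite_chain D) h u"
    by metis
  with D s t st show "\<exists>D>0. \<exists>h\<in>mv_hom (mv_presented X R) (finite_chain D). h x \<noteq> h y"
    by metis
qed

lemma mv_separated_subalgebra:
  assumes "f \<in> mv_hom A B" "inj_on f (carrier A)" "mv_separated B"
  shows "mv_separated A"
  unfolding mv_separated_def
proof (intro ballI impI)
  fix x y assume xy: "x \<in> carrier A" "y \<in> carrier A" "x \<noteq> y"
  then have "f x \<in> carrier B" "f y \<in> carrier B" "f x \<noteq> f y"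
    using assms(1,2) mv_hom_carrier inj_onD by metis+
  then obtain D h where "0 < D" "h \<in> mv_hom B (finite_chain D)" "h (f x) \<noteq> h (f y)"
    using assms(3) unfolding mv_separated_def by blast
  then show "\<exists>D>0. \<exists>h\<in>mv_hom A (finite_chain D). h x \<noteq> h y"
    using mv_hom_comp[OF assms(1)] by (intro exI[of _ D] conjI bexI[of _ "h \<circ> f"]) simp_all
qed

lemma mv_hom_eq_on_generate:
  assumes "f \<in> mv_hom A B" "g \<in> mv_hom A B" "mv_generate A S = carrier A"
    and "\<And>x. x \<in> S \<Longrightarrow> f x = g x" and "x \<in> carrier A"
  shows "f x = g x"
proof -
  have "x \<in> mv_generate A S"
    using assms(3,5) by simp
  then show ?thesis
    by induction (use assms in \<open>auto simp: mv_hom_def\<close>)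
qed

lemma mv_hopfian_of_separated:
  assumes fg: "mv_finitely_generated A" and sep: "mv_separated A"
  shows "mv_hopfian A"
  unfolding mv_hopfian_def
proof (intro ballI impI)
  fix f assume f: "f \<in> mv_hom A A" and surj: "f ` carrier A = carrier A"
  obtain S where S: "finite S" "S \<subseteq> carrier A" "mv_generate A S = carrier A"
    using fg unfolding mv_finitely_generated_def by blast
  have "inj_on f (carrier A)"
  proof (rule inj_onI, rule ccontr)
    fix x y assume x: "x \<in> carrier A" and y: "y \<in> carrier A" and fxy: "f x = f y" and "x \<noteq> y"
    then obtain D h where h: "h \<in> mv_hom A (finite_chain D)" "h x \<noteq> h y"
      using sep unfolding mv_separated_def by blast
    note hom = mv_hom_comp[OF mv_hom_funpow[OF f] h(1)]
    \<comment> \<open>Pigeonhole: a homomorphism is determined on the finite generating set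
      \<open>S\<close>, where only finitely many maps into \<open>{..D}\<close> exist.\<close>
    have "range (\<lambda>n. restrict (h \<circ> f ^^ n) S) \<subseteq> S \<rightarrow>\<^sub>E {..D}"
      using mv_hom_carrier[OF hom] S(2) by fastforce
    moreover have "finite (S \<rightarrow>\<^sub>E {..D})"
      using S(1) by (simp add: finite_PiE)
    ultimately have "finite (range (\<lambda>n. restrict (h \<circ> f ^^ n) S))"
      by (rule finite_subset)
    then have "\<not> inj (\<lambda>n. restrict (h \<circ> f ^^ n) S)"
      using finite_imageD by blast
    then obtain i j where "i \<noteq> j" "restrict (h \<circ> f ^^ i) S = restrict (h \<circ> f ^^ j) S"
      by (auto simp: inj_on_def)
    then obtain i j where ij: "i < j" "restrict (h \<circ> f ^^ i) S = restrict (h \<circ> f ^^ j) S"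
      by (metis linorder_neq_iff)
    have eq: "h ((f ^^ i) z) = h ((f ^^ j) z)" if z: "z \<in> carrier A" for z
      using mv_hom_eq_on_generate[OF hom[of i] hom[of j] S(3) _ z] ij(2)
      by (metis comp_apply restrict_apply')
    have surj_i: "(f ^^ i) ` carrier A = carrier A"
    proof (induction i)
      case (Suc i)
      have "(f ^^ Suc i) ` carrier A = f ` (f ^^ i) ` carrier A"
        by (simp add: image_image)
      then show ?case
        by (simp only: Suc surj)
    qed simp
    \<comment> \<open>Surjectivity of \<open>f ^^ i\<close> allows it to be cancelled on the
      right.\<close>
    have "h z = h ((f ^^ (j - i)) z)" if z: "z \<in> carrier A" for z
    proof -
      obtain u where u: "u \<in> carrier A" "z = (f ^^ i) u"
        using z surj_i by blast
      have "(f ^^ j) u = (f ^^ (j - i)) z"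
        using u(2) ij(1) funpow_add[of "j - i" i f] by simp
      with eq[OF u(1)] u(2) show ?thesis
        by simp
    qed
    \<comment> \<open>As \<open>i < j\<close>, at least one \<open>f\<close> remains and can be
      applied first, which merges \<open>x\<close> and \<open>y\<close>.\<close>
    moreover have "(f ^^ (j - i)) x = (f ^^ (j - i)) y"
    proof -
      obtain k where "j - i = Suc k"
        using ij(1) by (metis Suc_diff_Suc)
      then show ?thesis
        using fxy by (simp only: funpow_Suc_right comp_apply)
    qed
    ultimately show False
      using h(2) x y by simp
  qed
  with f surj show "f \<in> mv_iso A A"
    by (simp add: mv_iso_def bij_betw_def)
qed

section \<open>Finite generation of images and of presented algebras\<close>

lemma mv_finitely_generated_image:
  assumes A: "mv_finitely_generated A" and f: "f \<in> mv_hom A B" and surj: "f ` carrier A = carrier B"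
    and B: "mv_algebra B"
  shows "mv_finitely_generated B"
proof -
  interpret B: mv_algebra B
    by (rule B)
  obtain S where S: "finite S" "S \<subseteq> carrier A" "mv_generate A S = carrier A"
    using A unfolding mv_finitely_generated_def by blast
  have "f x \<in> mv_generate B (f ` S)" if "x \<in> mv_generate A S" for x
    using that
  proof induction
    case zero
    have "f \<zero>\<^bsub>A\<^esub> = \<zero>\<^bsub>B\<^esub>"
      using f by (simp add: mv_hom_def)
    then show ?case
      by (simp add: mv_generate.zero)
  next
    case (plus x y)
    then have "x \<in> carrier A" "y \<in> carrier A"
      using S(3) by simp_all
    then have "f (x \<oplus>\<^bsub>A\<^esub> y) = f x \<oplus>\<^bsub>B\<^esub> f y"
      using f by (simp add: mv_hom_def)
    with plus.IH show ?case
      by (simp add: mv_generate.plus)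
  next
    case (neg x)
    then have "x \<in> carrier A"
      using S(3) by simp
    then have "f (\<sim>\<^bsub>A\<^esub> x) = \<sim>\<^bsub>B\<^esub> (f x)"
      using f by (simp add: mv_hom_def)
    with neg.IH show ?case
      by (simp add: mv_generate.neg)
  qed (simp add: mv_generate.incl)
  then have "f ` carrier A \<subseteq> mv_generate B (f ` S)"
    unfolding S(3) by (rule image_subsetI)
  moreover have fS: "f ` S \<subseteq> carrier B"
    using S(2) surj by blast
  moreover have "mv_generate B (f ` S) \<subseteq> carrier B"
  proof
    fix y assume "y \<in> mv_generate B (f ` S)"
    then show "y \<in> carrier B"
    proof induction
      case (incl y)
      with fS show ?case
        by (rule subsetD)
    qed simp_all
  qed
  ultimately have "mv_generate B (f ` S) = carrier B"
    unfolding surj by (intro equalityI)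
  with fS show ?thesis
    unfolding mv_finitely_generated_def using finite_imageI[OF S(1)] by (intro exI conjI)
qed

lemma mv_finitely_generated_presented:
  assumes R: "R \<subseteq> mv_terms X \<times> mv_terms X" and "finite X"
  shows "mv_finitely_generated (mv_presented X R)"
proof -
  let ?P = "mv_presented X R" and ?S = "(\<lambda>x. mv_cong X R `` {MVar x}) ` X"
  have gen: "mv_cong X R `` {t} \<in> mv_generate ?P ?S" if "t \<in> mv_terms X" for t
    using that
  proof (induction t)
    case (MVar x)
    then show ?case
      by (auto intro: mv_generate.incl)
  next
    case MZero
    then show ?case
      using mv_generate.zero[of ?P ?S] by (simp add: mv_presented_zero[OF R])
  next
    case (MPlus s t)
    then show ?case
      using mv_generate.plus[OF MPlus.IH] by (simp add: mv_presented_plus[OF R])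
  next
    case (MNeg t)
    then show ?case
      using mv_generate.neg[OF MNeg.IH] by (simp add: mv_presented_neg[OF R])
  qed
  have S: "?S \<subseteq> carrier ?P"
    by (intro image_subsetI mv_class_carrier[OF R]) simp
  have "x \<in> carrier ?P" if "x \<in> mv_generate ?P ?S" for x
    using that
  proof induction
    case (incl x)
    with S show ?case
      by (rule subsetD)
  next
    case zero
    show ?case
      using mv_class_carrier[OF R, of MZero] by (simp add: mv_presented_zero[OF R])
  next
    case (plus x y)
    then obtain s t where "s \<in> mv_terms X" "x = mv_cong X R `` {s}" "t \<in> mv_terms X" "y = mv_cong X R `` {t}"
      unfolding mv_presented_carrier[OF R] by (elim bexE)
    then show ?case
      using mv_class_carrier[OF R, of "MPlus s t"] by (simp add: mv_presented_plus[OF R])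
  next
    case (neg x)
    then obtain s where "s \<in> mv_terms X" "x = mv_cong X R `` {s}"
      unfolding mv_presented_carrier[OF R] by (elim bexE)
    then show ?case
      using mv_class_carrier[OF R, of "MNeg s"] by (simp add: mv_presented_neg[OF R])
  qed
  moreover have "x \<in> mv_generate ?P ?S" if x: "x \<in> carrier ?P" for x
  proof -
    obtain t where "t \<in> mv_terms X" "x = mv_cong X R `` {t}"
      using x unfolding mv_presented_carrier[OF R] by (elim bexE)
    then show ?thesis
      by (simp only: gen)
  qed
  ultimately have "mv_generate ?P ?S = carrier ?P"
    by (intro equalityI subsetI)
  with S show ?thesis
    unfolding mv_finitely_generated_def using finite_imageI[OF \<open>finite X\<close>] by (intro exI conjI)
qed

text \<open>An isomorphism with a presented algebra is given as a map out of \<open>A\<close>,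
  whereas generators have to be carried back to \<open>A\<close>.\<close>

lemma mv_iso_inverse:
  assumes A: "mv_algebra A" and f: "f \<in> mv_iso A B"
  shows "inv_into (carrier A) f \<in> mv_hom B A" and "inv_into (carrier A) f ` carrier B = carrier A"
proof -
  interpret A: mv_algebra A
    by (rule A)
  let ?g = "inv_into (carrier A) f"
  have hom: "f \<in> mv_hom A B" and bij: "bij_betw f (carrier A) (carrier B)"
    using f by (simp_all add: mv_iso_def)
  have inv: "?g (f x) = x" if "x \<in> carrier A" for x
    using bij that by (simp add: bij_betw_inv_into_left)
  have surj: "\<exists>x\<in>carrier A. y = f x" if "y \<in> carrier B" for y
    using bij that by (auto simp: bij_betw_def)
  show img: "?g ` carrier B = carrier A"
    using bij_betw_inv_into[OF bij] by (simp add: bij_betw_def)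
  show "?g \<in> mv_hom B A"
    unfolding mv_hom_def
  proof (intro CollectI conjI ballI)
    show "?g \<in> carrier B \<rightarrow> carrier A"
      using img by blast
    show "?g \<zero>\<^bsub>B\<^esub> = \<zero>\<^bsub>A\<^esub>"
      using inv[OF A.zero_closed] hom by (simp add: mv_hom_def)
    show "?g (y \<oplus>\<^bsub>B\<^esub> z) = ?g y \<oplus>\<^bsub>A\<^esub> ?g z" if yz: "y \<in> carrier B" "z \<in> carrier B" for y z
    proof -
      obtain a b where ab: "a \<in> carrier A" "y = f a" "b \<in> carrier A" "z = f b"
        using surj yz by blast
      then have "y \<oplus>\<^bsub>B\<^esub> z = f (a \<oplus>\<^bsub>A\<^esub> b)"
        using hom by (simp add: mv_hom_def)
      then show ?thesis
        using ab inv by simp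
    qed
    show "?g (\<sim>\<^bsub>B\<^esub> y) = \<sim>\<^bsub>A\<^esub> (?g y)" if y: "y \<in> carrier B" for y
    proof -
      obtain a where ab: "a \<in> carrier A" "y = f a"
        using surj y by blast
      then have "\<sim>\<^bsub>B\<^esub> y = f (\<sim>\<^bsub>A\<^esub> a)"
        using hom by (simp add: mv_hom_def)
      then show ?thesis
        using ab inv by simp
    qed
  qed
qed

lemma mv_separated_isomorphic:
  assumes "mv_isomorphic A B" "mv_separated B"
  shows "mv_separated A"
  using assms mv_separated_subalgebra[of _ A B]
  by (auto simp: mv_isomorphic_def mv_iso_def bij_betw_def)

section \<open>Finitely presented, free and projective algebras\<close>

lemma mv_hopfian_finitely_presented:
  assumes A: "mv_algebra A" and fp: "mv_finitely_presented A"
  shows "mv_hopfian A"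
proof -
  obtain n :: nat and R where R: "finite R" "R \<subseteq> mv_terms {..<n} \<times> mv_terms {..<n}"
    and iso: "mv_isomorphic A (mv_presented {..<n} R)"
    using fp unfolding mv_finitely_presented_def by blast
  then obtain f where "f \<in> mv_iso A (mv_presented {..<n} R)"
    unfolding mv_isomorphic_def by blast
  then have "mv_finitely_generated A"
    using mv_finitely_generated_image[OF mv_finitely_generated_presented[OF R(2)]]
      mv_iso_inverse[OF A] A by blast
  moreover have "mv_separated A"
    using mv_separated_isomorphic[OF iso] mv_separated_presented[OF R(2,1)] by blast
  ultimately show ?thesis
    by (rule mv_hopfian_of_separated)
qed

text \<open>The empty set of relations is finite, whatever the size of the generating set.\<close>

lemma mv_separated_free:
  assumes "mv_free A"
  shows "mv_separated A"
  using assms mv_separated_isomorphic mv_separated_presented[of "{}"] unfolding mv_free_def by blast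

text \<open>The identity lifts along the canonical surjection from the free algebra on the carrier.
  The lift is a section, hence injective, and separation is inherited from the free algebra.\<close>

lemma mv_separated_projective:
  fixes A :: "'a mv"
  assumes A: "mv_algebra A" and proj: "mv_projective A"
  shows "mv_separated A"
proof -
  let ?F = "mv_presented (carrier A) {}"
  have F: "mv_algebra ?F"
    using mv_presented_mv_algebra_of_model[OF A, of "{}" "carrier A" id] by simp
  have "\<exists>g\<in>mv_hom ?F A. \<forall>x\<in>carrier A. g (mv_cong (carrier A) {} `` {MVar x}) = id x"
    using mv_free_universal[OF A, of id "carrier A"] by auto
  then obtain g where g: "g \<in> mv_hom ?F A" "\<And>x. x \<in> carrier A \<Longrightarrow> g (mv_cong (carrier A) {} `` {MVar x}) = x"
    by auto
  have "g ` carrier ?F = carrier A"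
  proof
    show "g ` carrier ?F \<subseteq> carrier A"
      using mv_hom_carrier[OF g(1)] by blast
    show "carrier A \<subseteq> g ` carrier ?F"
    proof
      fix x assume x: "x \<in> carrier A"
      then have "mv_cong (carrier A) {} `` {MVar x} \<in> carrier ?F"
        by (simp add: mv_class_carrier)
      with g(2)[OF x] show "x \<in> g ` carrier ?F"
        by force
    qed
  qed
  moreover have "id \<in> mv_hom A A"
    by (simp add: mv_hom_def)
  ultimately obtain s where s: "s \<in> mv_hom A ?F" "\<And>x. x \<in> carrier A \<Longrightarrow> x = g (s x)"
    using mv_projective_lifting[OF proj A F A g(1)] by fastforce
  have "inj_on s (carrier A)"
    using s(2) by (metis inj_onI)
  then show ?thesis
    using mv_separated_subalgebra[OF s(1)] mv_separated_presented[of "{}" "carrier A"] by simp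
qed

theorem corollary3p2:
  fixes A :: "'a mv"
  assumes "mv_algebra A"
  shows "(mv_finitely_presented A \<longrightarrow> mv_hopfian A) \<and>
    (mv_finitely_generated A \<and> mv_projective A \<longrightarrow> mv_hopfian A) \<and>
    (mv_finitely_generated A \<and> mv_free A \<longrightarrow> mv_hopfian A)"
  using mv_hopfian_finitely_presented[OF assms] mv_separated_projective[OF assms]
    mv_separated_free[of A] mv_hopfian_of_separated[of A]
  by blast

end
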